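(* Let $K\geq 1$. Let $\Omega$ be a domain in $\mathbb{R}^{m+n}$, $m\geq n\geq 2$. Let $u:\Omega\rightarrow[-\infty,+\infty)$ be a Lebesgue measurable function. Suppose that the following conditions are satisfied: (a) For each $y\in\mathbb{R}^n$ the function $\Omega(y)\ni x\mapsto u(x,y)\in[-\infty,+\infty)$ is $K$-quasinearly subharmonic. (b) For each $x\in\mathbb{R}^m$ the function $\Omega(x)\ni y\mapsto u(x,y)\in[-\infty,+\infty)$ is $K$-quasinearly subharmonic. (c) There are increasing functions $\varphi:[0,+\infty)\rightarrow[0,+\infty)$ and $\psi:[0,+\infty)\rightarrow[0,+\infty)$ and $s_0,s_1\in\mathbb{N}$, $s_0<s_1$, such that (c1) the inverse functions $\varphi^{-1}$ and $\psi^{-1}$ are defined on $[\min\{\varphi(s_1-s_0),\psi(s_1-s_0)\},+\infty)$, (c2) $2K(\psi^{-1}\circ\varphi)(s-s_0)\leq(\psi^{-1}\circ\varphi)(s)$ for all $s\geq s_1$, (c3) the following integral is convergent: $$\int_{s_5}^{+\infty}\left[\frac{(\psi^{-1}\circ\varphi)(s+2)}{(\psi^{-1}\circ\varphi)(s)}\cdot\frac{1}{\varphi(s-s_0)}\right]^{\frac{1}{m-1}}\cdot\left(\int_{s_5+s_0+2}^{s+s_0+2}\left[\frac{(\psi^{-1}\circ\varphi)(t+2)}{(\psi^{-1}\circ\varphi)(t)}\right]^{\frac{1}{n-1}}dt\right)^{\frac{n-1}{m-1}}ds<+\infty,$$ where $s_5:=\max\{s_0+s_1+3,\ s_0+(\psi^{-1}\circ\varphi)(s_1+3),\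 s_0+(\varphi^{-1}\circ\psi)(s_1+3)\}$, (c4) $\psi\circ u^+\in\mathcal{L}^1_{\mathrm{loc}}(\Omega)$. Then $u$ is quasinearly subharmonic in $\Omega$.
   Context: Points of $\mathbb{R}^{m+n}$ are written $(x,y)$ with $x\in\mathbb{R}^m$, $y\in\mathbb{R}^n$; the sections of $\Omega$ are $\Omega(y)=\{x\in\mathbb{R}^m:(x,y)\in\Omega\}$ and $\Omega(x)=\{y\in\mathbb{R}^n:(x,y)\in\Omega\}$ (open, possibly empty sets; the conditions are vacuous for empty sections). $u^+=\max\{u,0\}$. Definition. Let $D\subset\mathbb{R}^N$ be open, $N\geq2$, and $K\geq1$. A Lebesgue measurable function $v:D\rightarrow[-\infty,+\infty)$ is $K$-quasinearly subharmonic if $v^+\in\mathcal{L}^1_{\mathrm{loc}}(D)$ and, for all balls $\overline{B^N(x,r)}\subset D$ and all $M\geq0$, $$v_M(x)\leq\frac{K}{\nu_N r^N}\int_{B^N(x,r)}v_M(y)\,dm_N(y),\qquad v_M:=\max\{v,-M\}+M,$$ where $m_N$ is Lebesgue measure on $\mathbb{R}^N$ and $\nu_N$ is the measure of the unit ball. The function $v$ is quasinearly subharmonic if it is $K'$-quasinearly subharmonic for some $K'\geq1$. That an inverse function $\varphi^{-1}$ (or $\psi^{-1}$) is defined on an interval $I$ means that every value in $I$ is attained by the increasing function at exactly one point. *)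

theory Defs
  imports "HOL-Analysis.Analysis"
begin

text \<open>Local integrability over an open set \<open>D\<close>: Lebesgue integrability over each compact subset.\<close>

definition locally_integrable_on :: "('a::euclidean_space \<Rightarrow> real) \<Rightarrow> 'a set \<Rightarrow> bool"
    (infix "locally'_integrable'_on" 46) where
  "f locally_integrable_on D \<longleftrightarrow> (\<forall>C. compact C \<and> C \<subseteq> D \<longrightarrow> set_integrable lebesgue C f)"

text \<open>Functions with values in \<open>[-\<infinity>, \<infinity>)\<close> are \<open>ereal\<close>-valued, with the value \<open>\<infinity>\<close> excluded on the
  domain. The positive part and the lifted truncation \<open>max {v, -M} + M\<close> are then real-valued there,
  so \<open>real_of_ereal\<close> loses nothing.\<close>

definition pos_part :: "('a \<Rightarrow> ereal) \<Rightarrow> 'a \<Rightarrow> real" where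
  "pos_part v x = real_of_ereal (max (v x) 0)"

definition lifted_trunc :: "real \<Rightarrow> ('a \<Rightarrow> ereal) \<Rightarrow> 'a \<Rightarrow> real" where
  "lifted_trunc M v x = real_of_ereal (max (v x) (- ereal M)) + M"

text \<open>The Bochner integral below is never a default value: on a closed ball in \<open>D\<close> the integrand is
  measurable and lies between \<open>0\<close> and \<open>pos_part v + M\<close>.\<close>

definition K_quasinearly_subharmonic_on ::
    "real \<Rightarrow> 'a::euclidean_space set \<Rightarrow> ('a \<Rightarrow> ereal) \<Rightarrow> bool" where
  "K_quasinearly_subharmonic_on K D v \<longleftrightarrow>
     DIM('a) \<ge> 2 \<and> open D \<and> K \<ge> 1 \<and>
     (\<forall>x\<in>D. v x < \<infinity>) \<and>
     v \<in> borel_measurable (lebesgue_on D) \<and>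
     pos_part v locally_integrable_on D \<and>
     (\<forall>x r M. r > 0 \<and> cball x r \<subseteq> D \<and> M \<ge> 0 \<longrightarrow>
        lifted_trunc M v x \<le>
          K / (measure lebesgue (ball (0::'a) 1) * r ^ DIM('a)) *
          (LINT y:ball x r|lebesgue. lifted_trunc M v y))"

definition quasinearly_subharmonic_on :: "'a::euclidean_space set \<Rightarrow> ('a \<Rightarrow> ereal) \<Rightarrow> bool" where
  "quasinearly_subharmonic_on D v \<longleftrightarrow> (\<exists>K\<ge>1. K_quasinearly_subharmonic_on K D v)"

text \<open>For \<open>f\<close> on \<open>[0, \<infinity>)\<close>: every value in \<open>I\<close> is attained exactly once. On such an \<open>I\<close>,
  \<open>inv_into {0..} f\<close> is the inverse of \<open>f\<close>; no injectivity of \<open>f\<close> is required elsewhere.\<close>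

definition inverse_defined_on :: "real set \<Rightarrow> (real \<Rightarrow> real) \<Rightarrow> bool" where
  "inverse_defined_on I f \<longleftrightarrow> (\<forall>t\<in>I. \<exists>!x. x \<in> {0..} \<and> f x = t)"

end

theory Submission
  imports Defs
begin

text \<open>
  The main point is that \<open>u\<close> is locally bounded above; then \<open>pos_part u\<close> is locally integrable and
  the mean value inequality on balls follows from applying the two separate ones on a product of balls
  and Fubini.

  Write \<open>G j = g (real j)\<close>. Domar's argument in the variable \<open>x\<close> shows that \<open>u (x, y) > G k\<close> forces
  \<open>F y = \<integral> \<psi> (pos_part u (x, y)) dx\<close> to be at least a constant times \<open>S k powr (1 - m)\<close>, where \<open>S k\<close>
  is the tail of the series with terms \<open>(G (j + 1) / G j / \<phi> (j - s0)) powr (1 / (m - 1))\<close>.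
  As \<open>F\<close> is integrable, the same argument in \<open>y\<close>, with these lower bounds for \<open>F\<close> in the role of the
  lower bounds \<open>\<phi> (j - s0)\<close> for \<open>\<psi> \<circ> pos_part u\<close>, bounds \<open>u\<close>, provided that the series
  \<open>(G (k + 1) / G k) powr (1 / (n - 1)) * S (k - s0) powr p\<close>, \<open>p = (m - 1) / (n - 1) \<ge> 1\<close>, converges.
  This is a dual form of the convergence condition on the integral, obtained by summation by parts.
\<close>

subsection \<open>Duality for series with power weights\<close>

lemma powr_diff_le:
  fixes x y p :: real
  assumes "0 < y" "y \<le> x" "1 \<le> p"
  shows "x powr p - y powr p \<le> p * x powr (p - 1) * (x - y)"
proof (cases "y = x")
  case False
  then have xy: "y < x" using assms by simp
  have "\<exists>z. y < z \<and> z < x \<and> x powr p - y powr p = (x - y) * (p * z powr (p - 1))"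
  proof (rule MVT2[OF xy])
    fix z assume "y \<le> z" "z \<le> x"
    then show "((\<lambda>x. x powr p) has_real_derivative p * z powr (p - 1)) (at z)"
      using assms by (intro has_real_derivative_powr) auto
  qed
  then obtain z where z: "y < z" "z < x" "x powr p - y powr p = (x - y) * (p * z powr (p - 1))"
    by blast
  have "z powr (p - 1) \<le> x powr (p - 1)"
    using z assms by (intro powr_mono2) auto
  then have "(x - y) * (p * z powr (p - 1)) \<le> (x - y) * (p * x powr (p - 1))"
    using xy assms by (intro mult_left_mono) auto
  then show ?thesis using z by (simp add: mult_ac)
qed auto

lemma abel_sum:
  fixes b T :: "nat \<Rightarrow> real"
  shows "(\<Sum>k\<le>n. b k * T k) = (\<Sum>i\<le>n. b i) * T (Suc n) + (\<Sum>k\<le>n. (\<Sum>i\<le>k. b i) * (T k - T (Suc k)))"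
  by (induction n) (simp_all add: algebra_simps)

text \<open>A Hardy-type duality between the partial sums \<open>B\<close> of \<open>b\<close> and
  the tails \<open>S\<close> of \<open>c\<close>. Since \<open>B\<close> increases,
  \<open>S k * B k powr (1 / p)\<close> is at most the sum \<open>L\<close> of the given series.
  Summation by parts replaces \<open>b k * S k powr p\<close> by \<open>B k\<close> times a
  decrement of \<open>S powr p\<close>, and convexity of the power reduces this to a term of the
  given series.\<close>

lemma summable_tail_powr:
  fixes b c :: "nat \<Rightarrow> real" and p :: real
  assumes b: "\<And>i. 0 < b i" and c: "\<And>i. 0 < c i" and p: "1 \<le> p"
    and sm: "summable (\<lambda>j. c j * (\<Sum>i\<le>j. b i) powr (1 / p))"
  shows "summable c" and "summable (\<lambda>k. b k * (\<Sum>j. c (j + k)) powr p)"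
proof -
  define B where "B j = (\<Sum>i\<le>j. b i)" for j
  have B_pos: "0 < B j" for j unfolding B_def by (rule sum_pos) (auto simp: b)
  have B_mono: "B i \<le> B j" if "i \<le> j" for i j
    unfolding B_def using that by (intro sum_mono2) (auto intro: less_imp_le b)
  note sm' = sm[folded B_def]
  show c_sum: "summable c"
  proof (rule summable_comparison_test_ev)
    show "summable (\<lambda>j. (c j * B j powr (1 / p)) * (1 / B 0 powr (1 / p)))"
      by (rule summable_mult2[OF sm'])
    have "c j * B 0 powr (1 / p) \<le> c j * B j powr (1 / p)" for j
      using B_mono[of 0 j] B_pos[of 0] c[of j] p by (intro mult_left_mono powr_mono2) auto
    then show "\<forall>\<^sub>F j in sequentially. norm (c j) \<le> (c j * B j powr (1 / p)) * (1 / B 0 powr (1 / p))"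
      using B_pos[of 0] by (intro always_eventually) (auto simp: field_simps less_imp_le[OF c])
  qed
  define S where "S k = (\<Sum>j. c (j + k))" for k
  define L where "L = (\<Sum>j. c j * B j powr (1 / p))"
  have S_sm: "summable (\<lambda>j. c (j + k))" for k
    using c_sum by simp
  have S_pos: "0 < S k" for k unfolding S_def by (rule suminf_pos[OF S_sm]) (auto simp: c)
  have S_Suc: "S k = c k + S (Suc k)" for k
    unfolding S_def using suminf_split_head[OF S_sm[of k]] by simp
  have L_nonneg: "0 \<le> c j * B j powr (1/p)" for j
    using c[of j] by simp
  have SB: "S k * B k powr (1 / p) \<le> L" for k
  proof -
    have sk: "summable (\<lambda>j. c (j + k) * B (j + k) powr (1 / p))"
      using sm' by (subst summable_iff_shift[of "\<lambda>j. c j * B j powr (1/p)"]) 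
    have "S k * B k powr (1 / p) = (\<Sum>j. c (j + k) * B k powr (1 / p))"
      unfolding S_def by (rule suminf_mult2[OF S_sm])
    also have "\<dots> \<le> (\<Sum>j. c (j + k) * B (j + k) powr (1 / p))"
      using B_pos[of k] B_mono[of k] c p
      by (intro suminf_le summable_mult2 S_sm sk mult_left_mono powr_mono2) (auto simp: less_imp_le)
    also have "\<dots> \<le> L"
      unfolding L_def using suminf_split_initial_segment[OF sm', of k] L_nonneg
      by (simp add: sum_nonneg)
    finally show ?thesis .
  qed
  \<comment> \<open>\<open>B k\<close> is split into \<open>B k powr (1 / p)\<close> and its power
    \<open>p - 1\<close>: the first completes a term of the given series, the second joins
    \<open>S k powr (p - 1)\<close> and is absorbed by \<open>L\<close>.\<close>
  have term_le: "B k * (S k powr p - S (Suc k) powr p) \<le> p * L powr (p - 1) * (c k * B k powr (1 / p))" for k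
  proof -
    have "S k powr p - S (Suc k) powr p \<le> p * S k powr (p - 1) * c k"
      using powr_diff_le[of "S (Suc k)" "S k" p] S_pos S_Suc[of k] c[of k] p by simp
    then have "B k * (S k powr p - S (Suc k) powr p) \<le> B k * (p * S k powr (p - 1) * c k)"
      using B_pos[of k] by simp
    also have "\<dots> = (B k powr (1 / p) * (B k powr (1 / p)) powr (p - 1)) * (p * S k powr (p - 1) * c k)"
      using B_pos[of k] p by (simp add: powr_powr powr_add[symmetric] add_divide_distrib[symmetric])
    also have "\<dots> = p * (c k * B k powr (1 / p)) * (S k * B k powr (1 / p)) powr (p - 1)"
      using S_pos[of k] by (simp add: powr_mult)
    also have "\<dots> \<le> p * (c k * B k powr (1 / p)) * L powr (p - 1)"
      using SB[of k] S_pos[of k] p c[of k] by (intro mult_left_mono powr_mono2) auto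
    finally show ?thesis by (simp add: mult_ac)
  qed
  have "summable (\<lambda>k. b k * S k powr p)"
  proof (rule bounded_imp_summable)
    show "0 \<le> b k * S k powr p" for k using b[of k] by simp
    show "(\<Sum>k\<le>n. b k * S k powr p) \<le> L powr p + p * L powr (p - 1) * L" for n
    proof -
      \<comment> \<open>The boundary term of the summation by parts is bounded by \<open>SB\<close>
        as well.\<close>
      have "B n * S (Suc n) powr p \<le> B n * S n powr p"
        using S_Suc[of n] c[of n] B_pos[of n] S_pos[of "Suc n"] p by (intro mult_left_mono powr_mono2) auto
      also have "\<dots> = (S n * B n powr (1 / p)) powr p"
        using B_pos[of n] S_pos[of n] p by (simp add: powr_mult powr_powr)
      also have "\<dots> \<le> L powr p"
        using SB[of n] S_pos[of n] p by (intro powr_mono2) auto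
      finally have 1: "B n * S (Suc n) powr p \<le> L powr p" .
      have "(\<Sum>k\<le>n. B k * (S k powr p - S (Suc k) powr p))
          \<le> (\<Sum>k\<le>n. p * L powr (p - 1) * (c k * B k powr (1 / p)))"
        by (intro sum_mono term_le)
      also have "\<dots> = p * L powr (p - 1) * (\<Sum>k\<le>n. c k * B k powr (1 / p))"
        by (simp add: sum_distrib_left)
      also have "\<dots> \<le> p * L powr (p - 1) * L"
        unfolding L_def using p L_nonneg by (intro mult_left_mono sum_le_suminf sm') auto
      finally show ?thesis
        using 1 abel_sum[of b "\<lambda>k. S k powr p" n] by (simp add: B_def)
    qed
  qed
  then show "summable (\<lambda>k. b k * (\<Sum>j. c (j + k)) powr p)"
    by (simp add: S_def)
qed

subsection \<open>Mean value inequalities\<close>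

text \<open>Fubini is applied to Borel functions, while sections have to be controlled at every
  point. So an almost everywhere equal Borel function is raised to \<open>top\<close> on a Borel
  null set containing all discrepancies, which leaves the integral unchanged.\<close>

lemma lebesgue_borel_majorant:
  fixes f :: "'a::euclidean_space \<Rightarrow> ennreal"
  assumes "f \<in> borel_measurable lebesgue"
  obtains h where "h \<in> borel_measurable borel" "\<And>x. f x \<le> h x"
    "(\<integral>\<^sup>+x. h x \<partial>lborel) = (\<integral>\<^sup>+x. f x \<partial>lebesgue)"
proof -
  obtain f' where f': "f' \<in> borel_measurable lborel" "AE x in lborel. f x = f' x"
    using completion_ex_borel_measurable[OF assms] by blast
  from f'(2) obtain N where N: "N \<in> null_sets lborel" "{x. f x \<noteq> f' x} \<subseteq> N"
    by (auto simp: eventually_ae_filter)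
  define h where "h x = (if x \<in> N then top else f' x)" for x
  have Nb: "N \<in> sets borel" using N(1) by auto
  show thesis
  proof (rule that[of h])
    show "h \<in> borel_measurable borel"
      unfolding h_def using f'(1) Nb by (intro measurable_If_set) auto
    show "f x \<le> h x" for x
    proof (cases "x \<in> N")
      case False
      then have "f x = f' x" using N(2) by blast
      then show ?thesis using False by (simp add: h_def)
    qed (simp add: h_def)
    have "AE x in lborel. x \<notin> N" using N(1) by (rule AE_not_in)
    then have "AE x in lborel. f x = h x"
      using f'(2) by eventually_elim (simp add: h_def)
    then have "(\<integral>\<^sup>+x. f x \<partial>lborel) = (\<integral>\<^sup>+x. h x \<partial>lborel)" by (rule nn_integral_cong_AE)
    then show "(\<integral>\<^sup>+x. h x \<partial>lborel) = (\<integral>\<^sup>+x. f x \<partial>lebesgue)"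
      by (simp add: nn_integral_completion)
  qed
qed

lemma pos_part_nonneg: "0 \<le> pos_part v x"
  by (simp add: pos_part_def real_of_ereal_pos)

lemma lifted_trunc_0: "lifted_trunc 0 v = pos_part v"
  by (auto simp: lifted_trunc_def pos_part_def fun_eq_iff zero_ereal_def)

lemma lifted_trunc_nonneg: "0 \<le> M \<Longrightarrow> 0 \<le> lifted_trunc M v x"
  by (cases "v x") (auto simp: lifted_trunc_def max_def)

lemma lifted_trunc_le: "0 \<le> M \<Longrightarrow> lifted_trunc M v x \<le> pos_part v x + M"
  by (cases "v x") (auto simp: lifted_trunc_def pos_part_def max_def)

lemma unit_ball_measure_pos: "0 < measure lebesgue (ball (0 :: 'a::euclidean_space) 1)"
  using content_ball_pos[of 1 "0::'a"] by simp

lemma measure_lebesgue_ball: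
  fixes x :: "'a::euclidean_space"
  shows "0 \<le> r \<Longrightarrow> measure lebesgue (ball x r) = measure lebesgue (ball (0::'a) 1) * r ^ DIM('a)"
  using content_ball_conv_unit_ball[of r x] by simp

lemma emeasure_lebesgue_ball:
  fixes x :: "'a::euclidean_space"
  assumes "0 \<le> r"
  shows "emeasure lebesgue (ball x r) = ennreal (measure lebesgue (ball (0::'a) 1) * r ^ DIM('a))"
proof -
  have "emeasure lebesgue (ball x r) = ennreal (measure lebesgue (ball x r))"
    using emeasure_lborel_ball_finite[of x r] by (intro emeasure_eq_ennreal_measure) auto
  then show ?thesis using measure_lebesgue_ball[OF assms, of x] by simp
qed

text \<open>Nonnegative integrals combine with monotonicity and Fubini without any integrability of
  sections to track.\<close>

lemma K_quasinearly_subharmonic_mean_nn: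
  fixes x :: "'a::euclidean_space"
  assumes v: "K_quasinearly_subharmonic_on K D v" and "0 < r" "cball x r \<subseteq> D" "0 \<le> M"
  shows "ennreal (lifted_trunc M v x) \<le>
    ennreal (K / (measure lebesgue (ball (0::'a) 1) * r ^ DIM('a))) *
      (\<integral>\<^sup>+y\<in>ball x r. ennreal (lifted_trunc M v y) \<partial>lebesgue)"
proof -
  let ?c = "K / (measure lebesgue (ball (0::'a) 1) * r ^ DIM('a))"
  have c: "0 \<le> ?c"
    using v \<open>0 < r\<close> unit_ball_measure_pos[where 'a='a]
    by (auto simp: K_quasinearly_subharmonic_on_def)
  have "lifted_trunc M v x \<le> ?c * (LINT y:ball x r|lebesgue. lifted_trunc M v y)"
    using assms by (simp add: K_quasinearly_subharmonic_on_def)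
  then have "ennreal (lifted_trunc M v x) \<le> ennreal ?c * ennreal (LINT y:ball x r|lebesgue. lifted_trunc M v y)"
    using c by (simp add: ennreal_mult'[symmetric] ennreal_leI)
  also have "ennreal (LINT y:ball x r|lebesgue. lifted_trunc M v y)
      \<le> (\<integral>\<^sup>+y\<in>ball x r. ennreal (lifted_trunc M v y) \<partial>lebesgue)"
  proof (cases "set_integrable lebesgue (ball x r) (lifted_trunc M v)")
    case True
    then show ?thesis
      unfolding set_integrable_def set_lebesgue_integral_def
      using lifted_trunc_nonneg[OF \<open>0 \<le> M\<close>, of v]
      by (subst nn_integral_eq_integral[symmetric])
         (auto intro!: nn_integral_mono simp: indicator_def)
  next
    \<comment> \<open>The Bochner integral of a non-integrable function is 0, so the bound is
      trivial.\<close>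
    case False
    then show ?thesis
      by (simp add: set_integrable_def set_lebesgue_integral_def not_integrable_integral_eq)
  qed
  finally show ?thesis by (simp add: mult_left_mono)
qed

text \<open>The balls of one fixed radius about points of \<open>C\<close> lie in a single compact
  subset of \<open>D\<close>, so the mean value inequality with \<open>M = 0\<close> gives a
  multiple of one finite integral as a bound. It is what stops the chain of points in Domar's
  argument.\<close>

lemma K_quasinearly_subharmonic_bounded_above:
  fixes v :: "'a::euclidean_space \<Rightarrow> ereal"
  assumes v: "K_quasinearly_subharmonic_on K D v" and cpt: "compact C" and sub: "C \<subseteq> D"
  obtains L where "\<And>y. y \<in> C \<Longrightarrow> pos_part v y \<le> L"
proof -
  have "open D" using v by (simp add: K_quasinearly_subharmonic_on_def)
  then obtain d where d: "0 < d" "(\<Union>y\<in>C. cball y d) \<subseteq> D"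
    using compact_subset_open_imp_cball_epsilon_subset[OF cpt _ sub] by blast
  define C' where "C' = {y + z | y z. y \<in> C \<and> z \<in> cball 0 d}"
  have sub2: "cball y d \<subseteq> C'" if "y \<in> C" for y
  proof
    fix z assume "z \<in> cball y d"
    then have "z = y + (z - y)" "z - y \<in> cball 0 d" by (auto simp: dist_norm norm_minus_commute)
    then show "z \<in> C'" using that unfolding C'_def by blast
  qed
  have "compact C'" unfolding C'_def by (intro compact_sums cpt compact_cball)
  moreover have "C' \<subseteq> D"
  proof
    fix p assume "p \<in> C'"
    then obtain y z where "p = y + z" "y \<in> C" "norm z \<le> d" by (auto simp: C'_def)
    then have "p \<in> cball y d" by (simp add: dist_norm)
    then show "p \<in> D" using d \<open>y \<in> C\<close> by blast
  qed
  ultimately have "set_integrable lebesgue C' (pos_part v)"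
    using v by (auto simp: K_quasinearly_subharmonic_on_def locally_integrable_on_def)
  then have "(\<integral>\<^sup>+y\<in>C'. ennreal (pos_part v y) \<partial>lebesgue) < \<infinity>"
    unfolding set_integrable_def integrable_iff_bounded
    by (auto elim!: le_less_trans[rotated] intro!: nn_integral_mono 
        simp: indicator_def pos_part_nonneg)
  then obtain I where I: "(\<integral>\<^sup>+y\<in>C'. ennreal (pos_part v y) \<partial>lebesgue) = ennreal I" "0 \<le> I"
    by (cases "(\<integral>\<^sup>+y\<in>C'. ennreal (pos_part v y) \<partial>lebesgue)") auto
  let ?c = "K / (measure lebesgue (ball (0::'a) 1) * d ^ DIM('a))"
  have c: "0 \<le> ?c"
    using v \<open>0 < d\<close> unit_ball_measure_pos[where 'a='a]
    by (auto simp: K_quasinearly_subharmonic_on_def)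
  show thesis
  proof (rule that[of "?c * I"])
    fix y assume y: "y \<in> C"
    have "ennreal (pos_part v y) \<le> ennreal ?c * (\<integral>\<^sup>+z\<in>ball y d. ennreal (pos_part v z) \<partial>lebesgue)"
      using K_quasinearly_subharmonic_mean_nn[OF v \<open>0 < d\<close>, of y 0] y d by (auto simp: lifted_trunc_0)
    also have "\<dots> \<le> ennreal ?c * (\<integral>\<^sup>+y\<in>C'. ennreal (pos_part v y) \<partial>lebesgue)"
      using subset_trans[OF ball_subset_cball sub2[OF y]]
      by (intro mult_left_mono nn_integral_mono) (auto simp: indicator_def simp del: mem_ball)
    also have "\<dots> = ennreal (?c * I)"
      unfolding I(1) using c I(2) by (intro ennreal_mult[symmetric])
    finally show "pos_part v y \<le> ?c * I"
      using mult_nonneg_nonneg[OF c I(2)] by (subst (asm) ennreal_le_iff)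
  qed
qed

subsection \<open>Domar's argument\<close>

text \<open>The windows \<open>G (j - s0) < p \<le> G (j + 1)\<close> cover a given \<open>p\<close> at most \<open>s0 + 1\<close> times.\<close>

lemma sum_window_le:
  fixes G \<theta> :: "nat \<Rightarrow> real" and p :: real and h :: ennreal
  assumes s0: "s0 \<le> k"
    and G_mono: "\<And>i j. k - s0 \<le> i \<Longrightarrow> i \<le> j \<Longrightarrow> G i \<le> G j"
    and \<theta>: "\<And>j. k \<le> j \<Longrightarrow> G (j - s0) < p \<Longrightarrow> ennreal (\<theta> j) \<le> h"
  shows "(\<Sum>j\<in>{j\<in>{k..<J}. G (j - s0) < p \<and> p \<le> G (Suc j)}. ennreal (\<theta> j)) \<le> ennreal (real (s0 + 1)) * h"
proof -
  let ?I = "{j\<in>{k..<J}. G (j - s0) < p \<and> p \<le> G (Suc j)}"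
  have "card ?I \<le> s0 + 1"
  proof (cases "?I = {}")
    case False
    define a where "a = Min ?I"
    have fin: "finite ?I" by simp
    have a: "a \<in> ?I" unfolding a_def by (rule Min_in[OF fin False])
    have "?I \<subseteq> {a..a + s0}"
    proof
      fix j assume j: "j \<in> ?I"
      then have "a \<le> j" unfolding a_def using fin by (intro Min_le) auto
      moreover have "j \<le> a + s0"
      proof (rule ccontr)
        assume "\<not> j \<le> a + s0"
        then have "G (Suc a) \<le> G (j - s0)" using a s0 by (intro G_mono) auto
        then show False using a j by auto
      qed
      ultimately show "j \<in> {a..a + s0}" by simp
    qed
    then have "card ?I \<le> card {a..a + s0}" by (intro card_mono) auto
    then show ?thesis by simp
  next
    case True
    then have "card ?I = 0" by (simp only: card.empty)
    then show ?thesis by linarith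
  qed
  then have c: "of_nat (card ?I) \<le> ennreal (real (s0 + 1))"
    by (metis ennreal_of_nat_eq_real_of_nat of_nat_mono)
  have "(\<Sum>j\<in>?I. ennreal (\<theta> j)) \<le> of_nat (card ?I) * h"
    by (rule sum_bounded_above) (use \<theta> in auto)
  also have "\<dots> \<le> ennreal (real (s0 + 1)) * h"
    using c by (rule mult_right_mono) simp
  finally show ?thesis .
qed

text \<open>Domar's argument: if \<open>v\<close> exceeds \<open>G j\<close> at a point and \<open>G (j + 1)\<close> nowhere on a ball around it,
  then by the mean value inequality the set where \<open>G (j - s0) < v \<le> G (j + 1)\<close> must be large.
  So if \<open>\<integral> h\<close> is small, one can move from point to point to ever higher levels of \<open>v\<close> without leaving
  \<open>cball x0 r\<close>, on which \<open>v\<close> is bounded.\<close>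

lemma domar_bound:
  fixes v :: "'a::euclidean_space \<Rightarrow> ereal" and G w \<theta> :: "nat \<Rightarrow> real"
  assumes v: "K_quasinearly_subharmonic_on K D v"
    and r: "0 < r" "cball x0 r \<subseteq> D" and s0: "s0 \<le> k"
    and G_pos: "\<And>j. k - s0 \<le> j \<Longrightarrow> 0 < G j"
    and G_mono: "\<And>i j. k - s0 \<le> i \<Longrightarrow> i \<le> j \<Longrightarrow> G i \<le> G j"
    and G_doubling: "\<And>j. k \<le> j \<Longrightarrow> 2 * K * G (j - s0) \<le> G j"
    and G_lim: "filterlim G at_top sequentially"
    and h: "h \<in> borel_measurable lebesgue"
    and \<theta>_le: "\<And>j x. k \<le> j \<Longrightarrow> x \<in> cball x0 r \<Longrightarrow> G (j - s0) < pos_part v x \<Longrightarrow> ennreal (\<theta> j) \<le> h x"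
    and \<theta>_pos: "\<And>j. k \<le> j \<Longrightarrow> 0 < \<theta> j"
    and w_pos: "\<And>j. k \<le> j \<Longrightarrow> 0 < w j"
    and w: "\<And>j. k \<le> j \<Longrightarrow> G (Suc j) \<le> G j * \<theta> j * w j ^ (DIM('a) - 1)"
    and w_sum: "\<And>J. (\<Sum>j=k..<J. w j) \<le> S"
    and start: "G k < pos_part v x0"
  shows "ennreal (measure lebesgue (ball (0::'a) 1) * (r / 2) ^ DIM('a) / (2 * K * real (s0 + 1)) / S ^ (DIM('a) - 1))
    \<le> (\<integral>\<^sup>+x. h x \<partial>lebesgue)"
proof (rule ccontr)
  assume contr: "\<not> ?thesis"
  define N where "N = DIM('a)"
  define \<nu> where "\<nu> = measure lebesgue (ball (0::'a) 1)"
  have N: "N \<ge> 2" and K: "1 \<le> K"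
    using v by (auto simp: K_quasinearly_subharmonic_on_def N_def)
  have \<nu>: "0 < \<nu>" unfolding \<nu>_def by (rule unit_ball_measure_pos)
  have S: "0 < S" using w_sum[of "Suc k"] w_pos[of k] by simp
  \<comment> \<open>\<open>B\<close> is the claimed lower bound times \<open>s0 + 1\<close>, the
    possible overlap of the windows.\<close>
  define B where "B = \<nu> * (r / 2) ^ N / (2 * K * S ^ (N - 1))"
  have B_pos: "0 < B" using \<nu> r K S by (simp add: B_def)
  have small: "2 * K * B * S ^ (N - 1) = \<nu> * (r / 2) ^ N"
    using K S by (simp add: B_def)
  have h_le: "ennreal (real (s0 + 1)) * (\<integral>\<^sup>+x. h x \<partial>lebesgue) \<le> ennreal B"
  proof -
    have "ennreal (real (s0 + 1)) * (\<integral>\<^sup>+x. h x \<partial>lebesgue) \<le> ennreal (real (s0 + 1)) * 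
      ennreal (\<nu> * (r / 2) ^ N / (2 * K * real (s0 + 1)) / S ^ (N - 1))"
      using contr by (intro mult_left_mono) (auto simp: \<nu>_def N_def)
    also have "\<dots> = ennreal (real (s0 + 1) * (\<nu> * (r / 2) ^ N / (2 * K * real (s0 + 1)) / S ^ (N - 1)))"
      using \<nu> r K S by (intro ennreal_mult[symmetric]) auto
    also have "real (s0 + 1) * (\<nu> * (r / 2) ^ N / (2 * K * real (s0 + 1)) / S ^ (N - 1)) = B"
      using K S unfolding B_def by (simp add: field_simps del: of_nat_Suc)
    finally show ?thesis .
  qed
  define A where "A j = {x \<in> cball x0 r. G (j - s0) < pos_part v x \<and> pos_part v x \<le> G (Suc j)}" for j
  define \<mu> where "\<mu> j = measure lebesgue (A j)" for j
  have "set_integrable lebesgue (cball x0 r) (pos_part v)"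
    using v r by (auto simp: K_quasinearly_subharmonic_on_def locally_integrable_on_def)
  then have meas: "pos_part v \<in> borel_measurable (lebesgue_on (cball x0 r))"
    unfolding set_integrable_def
    by (subst borel_measurable_restrict_space_iff) (auto intro: borel_measurable_integrable)
  have A_sets: "A j \<in> sets lebesgue" for j
  proof -
    have "{x \<in> space (lebesgue_on (cball x0 r)). G (j - s0) < pos_part v x \<and> pos_part v x \<le> G (Suc j)}
        \<in> sets (lebesgue_on (cball x0 r))"
      using meas by measurable
    then show ?thesis
      by (simp add: A_def sets_restrict_space_iff)
  qed
  have A_emeasure: "emeasure lebesgue (A j) = ennreal (\<mu> j)" for j
  proof -
    have "emeasure lebesgue (A j) \<le> emeasure lebesgue (cball x0 r)"
      by (rule emeasure_mono) (auto simp: A_def)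
    also have "\<dots> < \<infinity>" using emeasure_lborel_cball_finite[of x0 r] by simp
    finally show ?thesis unfolding \<mu>_def by (intro emeasure_eq_ennreal_measure) auto
  qed
  have \<mu>: "0 \<le> \<mu> j" for j by (simp add: \<mu>_def)
  \<comment> \<open>On \<open>A j\<close> the function \<open>h\<close> is at least
    \<open>\<theta> j\<close>, and a point lies in at most \<open>s0 + 1\<close> of these
    sets.\<close>
  have \<mu>_sum: "(\<Sum>j=k..<J. \<theta> j * \<mu> j) \<le> B" for J
  proof -
    have "ennreal (\<Sum>j=k..<J. \<theta> j * \<mu> j) = (\<Sum>j=k..<J. ennreal (\<theta> j) * emeasure lebesgue (A j))"
      using \<theta>_pos \<mu> by (subst sum_ennreal[symmetric]) (auto simp: A_emeasure ennreal_mult less_imp_le)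
    also have "\<dots> = (\<Sum>j=k..<J. \<integral>\<^sup>+x. ennreal (\<theta> j) * indicator (A j) x \<partial>lebesgue)"
      using A_sets by (simp add: nn_integral_cmult_indicator)
    also have "\<dots> = (\<integral>\<^sup>+x. (\<Sum>j=k..<J. ennreal (\<theta> j) * indicator (A j) x) \<partial>lebesgue)"
      using A_sets by (intro nn_integral_sum[symmetric]) auto
    also have "\<dots> \<le> (\<integral>\<^sup>+x. ennreal (real (s0 + 1)) * h x \<partial>lebesgue)"
    proof (rule nn_integral_mono)
      fix x
      show "(\<Sum>j=k..<J. ennreal (\<theta> j) * indicator (A j) x) \<le> ennreal (real (s0 + 1)) * h x"
      proof (cases "x \<in> cball x0 r")
        case True
        have "(\<Sum>j=k..<J. ennreal (\<theta> j) * indicator (A j) x) =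
          (\<Sum>j\<in>{j\<in>{k..<J}. G (j - s0) < pos_part v x \<and> pos_part v x \<le> G (Suc j)}. ennreal (\<theta> j))"
          using True by (intro sum.mono_neutral_cong_right) (auto simp: A_def indicator_def)
        also have "\<dots> \<le> ennreal (real (s0 + 1)) * h x"
          using s0 G_mono \<theta>_le True by (intro sum_window_le) auto
        finally show ?thesis .
      qed (auto simp: A_def)
    qed
    also have "\<dots> = ennreal (real (s0 + 1)) * (\<integral>\<^sup>+x. h x \<partial>lebesgue)"
      using h by (rule nn_integral_cmult)
    also have "\<dots> \<le> ennreal B" by (rule h_le)
    finally show ?thesis using B_pos by (subst (asm) ennreal_le_iff) auto
  qed
  \<comment> \<open>Each radius is the sum of a multiple of \<open>w j\<close> and a multiple of \<open>\<theta> j * \<mu> j\<close>, two sequences with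
    bounded sums; as \<open>(X + Y) ^ N \<ge> X ^ (N - 1) * Y\<close>, this replaces Hoelder's inequality.\<close>
  define R where "R j = r / 2 * (w j / S + \<theta> j * \<mu> j / B)" for j
  have R_pos: "0 < R j" if "k \<le> j" for j
    using that r S B_pos w_pos[of j] \<theta>_pos[of j] \<mu>[of j] unfolding R_def
    by (intro mult_pos_pos add_pos_nonneg) auto
  have R_sum: "(\<Sum>j=k..<J. R j) \<le> r" for J
  proof -
    have "(\<Sum>j=k..<J. R j) = r / 2 * ((\<Sum>j=k..<J. w j) / S + (\<Sum>j=k..<J. \<theta> j * \<mu> j) / B)"
      by (simp only: R_def sum_distrib_left sum.distrib sum_divide_distrib distrib_left)
    also have "\<dots> \<le> r / 2 * (1 + 1)"
      using r S B_pos w_sum[of J] \<mu>_sum[of J] by (intro mult_left_mono add_mono) auto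
    finally show ?thesis by simp
  qed
  \<comment> \<open>In other words, in \<open>K\<close> times the mean over a ball of radius
    \<open>R j\<close>, the set \<open>A j\<close> with values up to \<open>G (Suc j)\<close>
    contributes at most \<open>G j / 2\<close>.\<close>
  have R_power: "2 * K * G (Suc j) * \<mu> j \<le> G j * (\<nu> * R j ^ N)" if j: "k \<le> j" for j
  proof -
    let ?X = "w j / S" and ?Y = "\<theta> j * \<mu> j / B"
    have XY: "0 \<le> ?X" "0 \<le> ?Y"
      using S B_pos w_pos[OF j] \<theta>_pos[OF j] \<mu>[of j] by auto
    have "?X ^ (N - 1) * ?Y \<le> (?X + ?Y) ^ (N - 1) * (?X + ?Y)"
      using XY by (intro mult_mono power_mono) auto
    also have "\<dots> = (?X + ?Y) ^ N"
      using N by (cases N) (auto simp: mult.commute)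
    finally have XYN: "?X ^ (N - 1) * ?Y \<le> (?X + ?Y) ^ N" .
    have "2 * K * G (Suc j) * \<mu> j \<le> 2 * K * (G j * \<theta> j * w j ^ (N - 1)) * \<mu> j"
      using w[OF j] K \<mu>[of j] by (intro mult_right_mono mult_left_mono) (auto simp: N_def)
    also have "\<dots> = G j * (2 * K * B * S ^ (N - 1)) * (?X ^ (N - 1) * ?Y)"
      using S B_pos by (simp add: power_divide)
    also have "\<dots> \<le> G j * (\<nu> * (r / 2) ^ N) * (?X ^ (N - 1) * ?Y)"
    proof (rule mult_right_mono[OF mult_left_mono])
      show "2 * K * B * S ^ (N - 1) \<le> \<nu> * (r / 2) ^ N" using small by simp
      show "0 \<le> G j" using j by (intro less_imp_le[OF G_pos]) simp
      show "0 \<le> ?X ^ (N - 1) * ?Y" using XY by (intro mult_nonneg_nonneg zero_le_power)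
    qed
    also have "\<dots> \<le> G j * (\<nu> * (r / 2) ^ N) * (?X + ?Y) ^ N"
    proof (rule mult_left_mono[OF XYN])
      show "0 \<le> G j * (\<nu> * (r / 2) ^ N)" using less_imp_le[OF G_pos[of j]] j \<nu> r by simp
    qed
    also have "\<dots> = G j * (\<nu> * R j ^ N)"
      by (simp only: R_def power_mult_distrib mult.assoc)
    finally show ?thesis .
  qed
  have step: "\<exists>y\<in>ball x (R j). G (Suc j) < pos_part v y"
    if j: "k \<le> j" and x: "G j < pos_part v x" and sub: "cball x (R j) \<subseteq> cball x0 r" for j x
  proof (rule ccontr)
    assume "\<not> ?thesis"
    then have le: "pos_part v y \<le> G (Suc j)" if "y \<in> ball x (R j)" for y
      using that by force
    have Gs: "0 < G (Suc j)" "0 < G (j - s0)" "0 < G j" using G_pos j by auto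
    have V: "0 < \<nu> * R j ^ N" using \<nu> R_pos[OF j] by simp
    \<comment> \<open>Points of the ball above level \<open>G (j - s0)\<close> belong to
      \<open>A j\<close>. All others have values at most \<open>G (j - s0)\<close> and, by
      \<open>G_doubling\<close>, contribute at most the other \<open>G j / 2\<close>.\<close>
    have "(\<integral>\<^sup>+y\<in>ball x (R j). ennreal (pos_part v y) \<partial>lebesgue)
        \<le> (\<integral>\<^sup>+y. ennreal (G (Suc j)) * indicator (A j) y
              + ennreal (G (j - s0)) * indicator (ball x (R j)) y \<partial>lebesgue)"
    proof (rule nn_integral_mono)
      fix y
      show "ennreal (pos_part v y) * indicator (ball x (R j)) y
        \<le> ennreal (G (Suc j)) * indicator (A j) y + ennreal (G (j - s0)) * indicator (ball x (R j)) y"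
      proof (cases "y \<in> ball x (R j)")
        case True
        then have "y \<in> cball x0 r" using subset_trans[OF ball_subset_cball sub] by blast
        show ?thesis
        proof (cases "G (j - s0) < pos_part v y")
          case True': True
          then have "y \<in> A j" using le[OF True] \<open>y \<in> cball x0 r\<close> by (simp add: A_def)
          then show ?thesis using le[OF True] True
            by (simp add: ennreal_leI add_increasing2)
        next
          case False
          then show ?thesis using True
            by (auto simp: ennreal_leI intro: add_increasing)
        qed
      qed simp
    qed
    also have "\<dots> = ennreal (G (Suc j)) * ennreal (\<mu> j) + ennreal (G (j - s0)) * ennreal (\<nu> * R j ^ N)"
    proof -
      have "ball x (R j) \<in> sets lebesgue" by simp
      moreover have "emeasure lebesgue (ball x (R j)) = ennreal (\<nu> * R j ^ N)"
        using R_pos[OF j] unfolding \<nu>_def N_def by (intro emeasure_lebesgue_ball) simp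
      ultimately show ?thesis
        using A_sets[of j]
        by (subst nn_integral_add) (simp_all only: nn_integral_cmult_indicator A_emeasure
            borel_measurable_const borel_measurable_times_ennreal borel_measurable_indicator)
    qed
    also have "\<dots> = ennreal (G (Suc j) * \<mu> j + G (j - s0) * (\<nu> * R j ^ N))"
      using Gs V \<mu>[of j] by (simp add: ennreal_mult ennreal_plus less_imp_le)
    finally have int: "(\<integral>\<^sup>+y\<in>ball x (R j). ennreal (pos_part v y) \<partial>lebesgue)
      \<le> ennreal (G (Suc j) * \<mu> j + G (j - s0) * (\<nu> * R j ^ N))" .
    have "ennreal (pos_part v x) \<le> ennreal (K / (\<nu> * R j ^ N)) *
       (\<integral>\<^sup>+y\<in>ball x (R j). ennreal (pos_part v y) \<partial>lebesgue)"
      using K_quasinearly_subharmonic_mean_nn[OF v R_pos[OF j], of x 0] sub r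
      by (auto simp: lifted_trunc_0 \<nu>_def N_def)
    also have "\<dots> \<le> ennreal (K / (\<nu> * R j ^ N)) * ennreal (G (Suc j) * \<mu> j + G (j - s0) * (\<nu> * R j ^ N))"
      by (rule mult_left_mono[OF int]) simp
    also have "\<dots> = ennreal (K / (\<nu> * R j ^ N) * (G (Suc j) * \<mu> j + G (j - s0) * (\<nu> * R j ^ N)))"
      using K V Gs \<mu>[of j] by (intro ennreal_mult[symmetric]) auto
    finally have "pos_part v x \<le> K / (\<nu> * R j ^ N) * (G (Suc j) * \<mu> j + G (j - s0) * (\<nu> * R j ^ N))"
      using K V Gs \<mu>[of j] by (subst (asm) ennreal_le_iff) (auto intro!: mult_nonneg_nonneg add_nonneg_nonneg)
    also have "\<dots> = (K * G (Suc j) * \<mu> j) / (\<nu> * R j ^ N) + K * G (j - s0)"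
    proof -
      have "K / W * (a + b * W) = K * a / W + K * b" if "0 < W" for W a b :: real
        using that by (simp add: field_simps)
      from this[OF V] show ?thesis by (simp add: mult.assoc)
    qed
    also have "\<dots> \<le> G j / 2 + G j / 2"
      using R_power[OF j] G_doubling[OF j] V by (intro add_mono) (auto simp: divide_le_eq mult_ac)
    finally show False using x by simp
  qed
  \<comment> \<open>The distance travelled is a partial sum of \<open>R\<close>; since these never
    exceed \<open>r\<close>, the next ball stays inside \<open>cball x0 r\<close> and
    \<open>step\<close> applies again.\<close>
  have chain: "\<exists>x. G (k + i) < pos_part v x \<and> dist x0 x \<le> (\<Sum>j=k..<k+i. R j)" for i
  proof (induction i)
    case 0
    show ?case using start by (intro exI[of _ x0]) auto
  next
    case (Suc i)
    then obtain x where x: "G (k + i) < pos_part v x" "dist x0 x \<le> (\<Sum>j=k..<k+i. R j)" by blast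
    have R_Suc: "(\<Sum>j=k..<k + Suc i. R j) = (\<Sum>j=k..<k+i. R j) + R (k + i)" by simp
    have "cball x (R (k + i)) \<subseteq> cball x0 r"
    proof
      fix z assume "z \<in> cball x (R (k + i))"
      then have "dist x0 z \<le> (\<Sum>j=k..<k + Suc i. R j)"
        using x(2) dist_triangle[of x0 z x] R_Suc by simp
      then show "z \<in> cball x0 r" using R_sum[of "k + Suc i"] by simp
    qed
    from step[OF _ x(1) this] obtain y where "y \<in> ball x (R (k + i))" "G (Suc (k + i)) < pos_part v y"
      by auto
    then show ?case using x(2) dist_triangle[of x0 y x] R_Suc
      by (intro exI[of _ y]) auto
  qed
  \<comment> \<open>The chain climbs to arbitrarily high levels within one compact ball, against
    boundedness.\<close>
  obtain L where L: "\<And>y. y \<in> cball x0 r \<Longrightarrow> pos_part v y \<le> L"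
    using K_quasinearly_subharmonic_bounded_above[OF v compact_cball r(2)] by blast
  obtain n where n: "\<And>j. n \<le> j \<Longrightarrow> L \<le> G j"
    using G_lim by (auto simp: filterlim_at_top eventually_sequentially)
  obtain x where x: "G (k + n) < pos_part v x" "dist x0 x \<le> (\<Sum>j=k..<k+n. R j)"
    using chain[of n] by blast
  then have "x \<in> cball x0 r" using R_sum[of "k + n"] by simp
  then show False using L n[of "k + n"] x(1) by fastforce
qed

section \<open>Local upper bound from Domar's argument in both variables\<close>

lemma pos_part_section: "pos_part (\<lambda>x. u (x, y)) x = pos_part u (x, y)"
  "pos_part (\<lambda>y. u (x, y)) y = pos_part u (x, y)"
  by (simp_all add: pos_part_def)

lemma sum_le_tail_suminf:
  fixes c :: "nat \<Rightarrow> real"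
  assumes "summable c" and "\<And>j. 0 \<le> c j"
  shows "(\<Sum>j=k..<J. c j) \<le> (\<Sum>j. c (j + k))"
proof -
  have "(\<Sum>j=k..<J. c j) = (\<Sum>i<J - k. c (i + k))"
    by (rule sum.reindex_bij_witness[of _ "\<lambda>i. i + k" "\<lambda>j. j - k"]) auto
  also have "\<dots> \<le> (\<Sum>j. c (j + k))"
    using assms by (intro sum_le_suminf) auto
  finally show ?thesis .
qed

lemma powr_power_eq:
  fixes x :: real
  assumes "0 < x" "2 \<le> N"
  shows "(x powr (1 / (real N - 1))) ^ (N - 1) = x"
proof -
  have "(x powr (1 / (real N - 1))) ^ (N - 1) = x powr (1 / (real N - 1) * real (N - 1))"
    using assms by (subst powr_realpow[symmetric]) (auto simp: powr_powr)
  then show ?thesis using assms by (simp add: of_nat_diff)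
qed

text \<open>\<open>P\<close> bounds \<open>\<psi>\<close> from below above the levels
  \<open>G\<close>. The weights \<open>w\<close> of the two passes are \<open>c\<close>, and
  \<open>b\<close> times a power of a tail of \<open>c\<close>. The first pass at level
  \<open>j\<close> reads \<open>G\<close> and \<open>P\<close> at \<open>j - s0\<close>, which must
  be at least \<open>q0\<close>, hence \<open>q0 + s0 \<le> q\<close>; the second reads the outcome
  of the first at \<open>j - s0\<close> and so starts at \<open>q + s0\<close>. Balls of radius
  \<open>\<rho>\<close> about points of the smaller product stay in the larger one.\<close>

lemma separately_qns_bounded_above:
  fixes \<Omega> :: "('a::euclidean_space \<times> 'b::euclidean_space) set"
    and G P c b :: "nat \<Rightarrow> real" and p :: real
  assumes a: "\<forall>y. K_quasinearly_subharmonic_on K {x. (x, y) \<in> \<Omega>} (\<lambda>x. u (x, y))"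
    and b: "\<forall>x. K_quasinearly_subharmonic_on K {y. (x, y) \<in> \<Omega>} (\<lambda>y. u (x, y))"
    and dims: "DIM('b) \<le> DIM('a)"
    and \<rho>: "0 < \<rho>" "cball x0 (2 * \<rho>) \<times> cball y0 (2 * \<rho>) \<subseteq> \<Omega>"
    and \<psi>: "set_integrable lebesgue (cball x0 (2 * \<rho>) \<times> cball y0 (2 * \<rho>)) (\<psi> \<circ> pos_part u)"
    and G_pos: "\<And>j. q0 \<le> j \<Longrightarrow> 0 < G j"
    and G_mono: "\<And>i j. q0 \<le> i \<Longrightarrow> i \<le> j \<Longrightarrow> G i \<le> G j"
    and G_doubling: "\<And>j. q0 \<le> j \<Longrightarrow> 2 * K * G j \<le> G (j + s0)"
    and G_lim: "filterlim G at_top sequentially"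
    and P_pos: "\<And>j. q0 \<le> j \<Longrightarrow> 0 < P j"
    and P_le: "\<And>j t. q0 \<le> j \<Longrightarrow> G j < t \<Longrightarrow> P j \<le> \<psi> t"
    and c_def: "\<And>j. c j = (G (Suc j) / G j / P (j - s0)) powr (1 / (real DIM('a) - 1))"
    and b_def: "\<And>j. b j = (G (Suc j) / G j) powr (1 / (real DIM('b) - 1))"
    and p_def: "p = (real DIM('a) - 1) / (real DIM('b) - 1)"
    and q: "q0 + s0 \<le> q"
    and sm: "summable (\<lambda>j. c (j + q) * (\<Sum>i\<le>j. b (i + (q + s0))) powr (1 / p))"
  obtains L where "\<And>x y. x \<in> cball x0 \<rho> \<Longrightarrow> y \<in> cball y0 \<rho> \<Longrightarrow> pos_part u (x, y) \<le> L"
proof -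
  let ?Q = "cball x0 (2 * \<rho>) \<times> cball y0 (2 * \<rho>)"
  let ?m = "DIM('a)" and ?n = "DIM('b)"
  have K: "1 \<le> K" and m2: "2 \<le> ?m" and n2: "2 \<le> ?n"
    using a b by (auto simp: K_quasinearly_subharmonic_on_def)
  have p1: "1 \<le> p" using dims n2 by (simp add: p_def field_simps)
  have c_pos: "0 < c (j + q)" and b_pos: "0 < b (j + (q + s0))" for j
    using G_pos[of "j + q"] G_pos[of "Suc (j + q)"] G_pos[of "j + (q + s0)"] 
      G_pos[of "Suc (j + (q + s0))"] P_pos[of "j + q - s0"] q
    by (simp_all add: c_def b_def less_imp_neq[symmetric])
  note tails = summable_tail_powr[of "\<lambda>i. b (i + (q + s0))" "\<lambda>j. c (j + q)", OF b_pos c_pos p1 sm]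
  define S where "S l = (\<Sum>j. c ((j + l) + q))" for l
  have S_sm: "summable (\<lambda>j. c ((j + l) + q))" for l
    using tails(1) by (subst summable_iff_shift[of "\<lambda>j. c (j + q)"])
  have S_pos: "0 < S l" for l unfolding S_def by (rule suminf_pos[OF S_sm]) (rule c_pos)

  have "(\<lambda>z. ennreal (indicator ?Q z * \<psi> (pos_part u z))) \<in> borel_measurable lebesgue"
    using \<psi> by (auto simp: set_integrable_def dest!: borel_measurable_integrable)
  then obtain h where h: "h \<in> borel_measurable borel"
      "\<And>z. ennreal (indicator ?Q z * \<psi> (pos_part u z)) \<le> h z"
      "(\<integral>\<^sup>+z. h z \<partial>lborel) = (\<integral>\<^sup>+z. ennreal (indicator ?Q z * \<psi> (pos_part u z)) \<partial>lebesgue)"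
    by (rule lebesgue_borel_majorant) blast
  have "(\<integral>\<^sup>+z. h z \<partial>lborel) < \<infinity>"
    unfolding h(3) using \<psi> unfolding set_integrable_def integrable_iff_bounded
    by (auto elim!: le_less_trans[rotated] intro!: nn_integral_mono ennreal_leI)
  then obtain A where A: "(\<integral>\<^sup>+z. h z \<partial>lborel) = ennreal A" "0 \<le> A"
    by (cases "\<integral>\<^sup>+z. h z \<partial>lborel") auto
  have h_pair: "h \<in> borel_measurable (lborel \<Otimes>\<^sub>M lborel)"
    using h(1) by (simp add: lborel_prod)
  \<comment> \<open>\<open>h\<close> majorizes everywhere, not just almost everywhere, so that every single section
    of \<open>u\<close> is controlled by \<open>F\<close>.\<close>
  define F where "F y = (\<integral>\<^sup>+x. h (x, y) \<partial>lborel)" for y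
  have F_meas: "F \<in> borel_measurable borel"
  proof -
    have "F \<in> borel_measurable lborel"
      unfolding F_def using measurable_compose[OF measurable_pair_swap' h_pair]
      by (intro lborel.borel_measurable_nn_integral) (simp add: case_prod_unfold)
    then show ?thesis by simp
  qed
  have F_int: "(\<integral>\<^sup>+y. F y \<partial>lebesgue) = ennreal A"
  proof -
    have "(\<integral>\<^sup>+y. F y \<partial>lborel) = (\<integral>\<^sup>+z. h z \<partial>(lborel \<Otimes>\<^sub>M lborel))"
      unfolding F_def by (rule lborel_pair.nn_integral_snd[OF h_pair])
    then show ?thesis using A(1) by (simp add: lborel_prod nn_integral_completion)
  qed
  define c1 where "c1 = measure lebesgue (ball (0::'a) 1) * (\<rho> / 2) ^ ?m / (2 * K * real (s0 + 1))"
  have c1: "0 < c1" using unit_ball_measure_pos[where 'a='a] \<rho> K by (simp add: c1_def)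

  \<comment> \<open>First pass, with \<open>y\<close> fixed: where \<open>u\<close> exceeds
    \<open>G (j - s0)\<close> on this section, \<open>h\<close> is at least
    \<open>P (j - s0)\<close>, and the weights \<open>c\<close> from index \<open>l + q\<close> on
    sum to at most \<open>S l\<close>.\<close>
  have slice: "ennreal (c1 / S l ^ (?m - 1)) \<le> F y"
    if x: "x \<in> cball x0 \<rho>" and y: "y \<in> cball y0 (2 * \<rho>)" and gt: "G (l + q) < pos_part u (x, y)" for x y l
  proof -
    have sub0: "cball x \<rho> \<subseteq> cball x0 (2 * \<rho>)"
    proof
      fix z assume "z \<in> cball x \<rho>"
      then show "z \<in> cball x0 (2 * \<rho>)" using x dist_triangle[of x0 z x] by auto
    qed
    have "ennreal (measure lebesgue (ball (0::'a) 1) * (\<rho> / 2) ^ ?m / (2 * K * real (s0 + 1)) / S l ^ (?m - 1))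
      \<le> (\<integral>\<^sup>+x. h (x, y) \<partial>lebesgue)"
    proof (rule domar_bound[where v = "\<lambda>x. u (x, y)" and k = "l + q" and \<theta> = "\<lambda>j. P (j - s0)" and w = c
          and G = G and D = "{x. (x, y) \<in> \<Omega>}"])
      show "cball x \<rho> \<subseteq> {x. (x, y) \<in> \<Omega>}" using sub0 \<rho> y by auto
      show "s0 \<le> l + q" using q by simp
      show "0 < G j" if "l + q - s0 \<le> j" for j using that q by (intro G_pos) simp
      show "G i \<le> G j" if "l + q - s0 \<le> i" "i \<le> j" for i j using that q by (intro G_mono) auto
      show "2 * K * G (j - s0) \<le> G j" if "l + q \<le> j" for j
        using that q G_doubling[of "j - s0"] by simp
      have "(\<lambda>x. h (x, y)) \<in> borel_measurable borel"
        using h(1) by measurable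
      then show "(\<lambda>x. h (x, y)) \<in> borel_measurable lebesgue"
        by (intro measurable_completion) simp
      show "ennreal (P (j - s0)) \<le> h (x', y)"
        if "l + q \<le> j" "x' \<in> cball x \<rho>" "G (j - s0) < pos_part (\<lambda>x. u (x, y)) x'" for j x'
      proof -
        have "P (j - s0) \<le> \<psi> (pos_part u (x', y))"
          using that q by (intro P_le) (auto simp: pos_part_section)
        moreover have "(x', y) \<in> ?Q" using sub0 that y by auto
        ultimately have "ennreal (P (j - s0)) \<le> ennreal (indicator ?Q (x', y) * \<psi> (pos_part u (x', y)))"
          by (intro ennreal_leI) simp
        then show ?thesis using h(2) order_trans by blast
      qed
      show "0 < P (j - s0)" if "l + q \<le> j" for j using that q by (intro P_pos) simp
      show "0 < c j" if "l + q \<le> j" for j using c_pos[of "j - q"] that by simp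
      show "G (Suc j) \<le> G j * P (j - s0) * c j ^ (?m - 1)" if "l + q \<le> j" for j
      proof -
        have *: "0 < G (Suc j)" "0 < G j" "0 < P (j - s0)" using that q by (auto intro!: G_pos P_pos)
        then have "c j ^ (?m - 1) = G (Suc j) / G j / P (j - s0)"
          unfolding c_def using m2 by (intro powr_power_eq) auto
        then show ?thesis using * by simp
      qed
      show "(\<Sum>j = l + q..<J. c j) \<le> S l" for J
      proof -
        have "(\<Sum>j = l + q..<J. c j) = (\<Sum>j = l..<J - q. c (j + q))"
          by (rule sum.reindex_bij_witness[of _ "\<lambda>j. j + q" "\<lambda>j. j - q"]) auto
        also have "\<dots> \<le> S l"
          unfolding S_def using tails(1) c_pos
          by (intro sum_le_tail_suminf[where c = "\<lambda>j. c (j + q)"]) (auto intro: less_imp_le)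
        finally show ?thesis .
      qed
      show "G (l + q) < pos_part (\<lambda>x. u (x, y)) x" using gt by (simp add: pos_part_section)
    qed (use a \<rho> G_lim in auto)
    then show ?thesis
      unfolding c1_def F_def by (simp add: nn_integral_completion)
  qed

  define X where "X = measure lebesgue (ball (0::'b) 1) * (\<rho> / 2) ^ ?n / (2 * K * real (s0 + 1))"
  have X: "0 < X" using unit_ball_measure_pos[where 'a='b] \<rho> K by (simp add: X_def)
  \<comment> \<open>\<open>C\<close> absorbs \<open>c1\<close> in the growth condition on
    \<open>w\<close>, and \<open>p\<close> is such that the power \<open>?n - 1\<close> of
    \<open>S powr p\<close> cancels the power \<open>?m - 1\<close> of \<open>S\<close> in the lower
    bound for \<open>F\<close>.\<close>
  define C where "C = (1 / c1) powr (1 / (real ?n - 1))"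
  have "C ^ (?n - 1) = 1 / c1"
    unfolding C_def using c1 n2 by (intro powr_power_eq) auto
  then have C: "0 < C" "c1 * C ^ (?n - 1) = 1"
    using c1 by (auto simp: C_def)
  define w where "w j = C * (b j * S (j - (q + s0)) powr p)" for j
  have w_pos: "0 < w (j + (q + s0))" for j
    using C b_pos[of j] S_pos[of j] by (simp add: w_def less_imp_neq[symmetric])
  have w_sm: "summable (\<lambda>j. w (j + (q + s0)))"
    using tails(2) by (simp add: w_def S_def add.assoc add.commute[of _ q] summable_mult)
  \<comment> \<open>\<open>x\<close> stays fixed along the second chain of points, so the supremum of \<open>u\<close> over \<open>x\<close>, which need
    not be measurable, never enters.\<close>
  define T where "T = min 1 (X / (A + 1))"
  have T: "0 < T" "T \<le> 1" "T \<le> X / (A + 1)" using X A by (auto simp: T_def)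
  \<comment> \<open>\<open>T\<close> takes the place of \<open>S\<close> in
    \<open>domar_bound\<close>. As \<open>T \<le> 1\<close>, \<open>X / T ^ (?n - 1)\<close> is at
    least \<open>X / T\<close> and hence at least \<open>A + 1\<close>, more than the integral
    \<open>A\<close> of \<open>F\<close>.\<close>
  obtain l where l: "norm (\<Sum>j. w (j + l + (q + s0))) < T"
    using suminf_exist_split[OF T(1) w_sm] by blast
  show thesis
  proof (rule that[of "G (l + (q + s0))"], rule ccontr)
    fix x y assume x: "x \<in> cball x0 \<rho>" and y: "y \<in> cball y0 \<rho>"
      and contr: "\<not> pos_part u (x, y) \<le> G (l + (q + s0))"
    have sub0: "cball y \<rho> \<subseteq> cball y0 (2 * \<rho>)"
    proof
      fix z assume "z \<in> cball y \<rho>"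
      then show "z \<in> cball y0 (2 * \<rho>)" using y dist_triangle[of y0 z y] by auto
    qed
    have "ennreal (measure lebesgue (ball (0::'b) 1) * (\<rho> / 2) ^ ?n / (2 * K * real (s0 + 1)) / T ^ (?n - 1))
      \<le> (\<integral>\<^sup>+y. F y \<partial>lebesgue)"
    \<comment> \<open>Second pass: \<open>slice\<close> at index \<open>j - (q + s0)\<close>
      concerns exactly the level \<open>G (j - s0)\<close>, which explains the choice of
      \<open>\<theta>\<close>.\<close>
    proof (rule domar_bound[where v = "\<lambda>y. u (x, y)" and k = "l + (q + s0)" and G = G and w = w
          and \<theta> = "\<lambda>j. c1 / S (j - (q + s0)) ^ (?m - 1)" and D = "{y. (x, y) \<in> \<Omega>}"])
      have "x \<in> cball x0 (2 * \<rho>)" using x \<rho> by simp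
      then show "cball y \<rho> \<subseteq> {y. (x, y) \<in> \<Omega>}" using sub0 \<rho>(2) by blast
      show "0 < G j" if "l + (q + s0) - s0 \<le> j" for j using that q by (intro G_pos) simp
      show "G i \<le> G j" if "l + (q + s0) - s0 \<le> i" "i \<le> j" for i j using that q by (intro G_mono) auto
      show "2 * K * G (j - s0) \<le> G j" if "l + (q + s0) \<le> j" for j
        using that q G_doubling[of "j - s0"] by simp
      show "F \<in> borel_measurable lebesgue" using F_meas by (intro measurable_completion) simp
      show "ennreal (c1 / S (j - (q + s0)) ^ (?m - 1)) \<le> F y'"
        if "l + (q + s0) \<le> j" "y' \<in> cball y \<rho>" "G (j - s0) < pos_part (\<lambda>y. u (x, y)) y'" for j y'
        using that sub0 by (intro slice[OF x]) (auto simp: pos_part_section)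
      show "0 < c1 / S (j - (q + s0)) ^ (?m - 1)" for j using c1 S_pos by simp
      show "0 < w j" if "l + (q + s0) \<le> j" for j using w_pos[of "j - (q + s0)"] that by simp
      show "G (Suc j) \<le> G j * (c1 / S (j - (q + s0)) ^ (?m - 1)) * w j ^ (?n - 1)"
        if "l + (q + s0) \<le> j" for j
      proof -
        let ?s = "S (j - (q + s0))"
        have *: "0 < G (Suc j)" "0 < G j" using that q by (auto intro!: G_pos)
        have "b j ^ (?n - 1) = G (Suc j) / G j"
          unfolding b_def using n2 * by (intro powr_power_eq) auto
        moreover have "(?s powr p) ^ (?n - 1) = ?s ^ (?m - 1)"
        proof -
          have "(?s powr p) ^ (?n - 1) = ?s powr (p * real (?n - 1))"
            using S_pos by (subst powr_realpow[symmetric]) (auto simp: powr_powr less_imp_neq[symmetric])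
          also have "p * real (?n - 1) = real (?m - 1)"
            using n2 m2 by (simp add: p_def of_nat_diff)
          also have "?s powr real (?m - 1) = ?s ^ (?m - 1)" by (rule powr_realpow[OF S_pos])
          finally show ?thesis .
        qed
        ultimately have "w j ^ (?n - 1) = C ^ (?n - 1) * (G (Suc j) / G j * ?s ^ (?m - 1))"
          by (simp add: w_def power_mult_distrib)
        then have "G j * (c1 / ?s ^ (?m - 1)) * w j ^ (?n - 1)
            = (c1 * C ^ (?n - 1)) * G (Suc j)"
          using * S_pos[of "j - (q + s0)"] by (simp add: field_simps)
        then show ?thesis using C(2) by simp
      qed
      show "(\<Sum>j = l + (q + s0)..<J. w j) \<le> T" for J
      proof -
        have "(\<Sum>j = l + (q + s0)..<J. w j) = (\<Sum>j = l..<J - (q + s0). w (j + (q + s0)))"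
          by (rule sum.reindex_bij_witness[of _ "\<lambda>j. j + (q + s0)" "\<lambda>j. j - (q + s0)"]) auto
        also have "\<dots> \<le> (\<Sum>j. w (j + l + (q + s0)))"
          using w_sm w_pos
          by (intro sum_le_tail_suminf[where c = "\<lambda>j. w (j + (q + s0))"]) (auto intro: less_imp_le)
        also have "\<dots> \<le> T" using l by simp
        finally show ?thesis .
      qed
      show "G (l + (q + s0)) < pos_part (\<lambda>y. u (x, y)) y" using contr by (simp add: pos_part_section)
    qed (use b \<rho> G_lim in auto)
    then have "ennreal (X / T ^ (?n - 1)) \<le> ennreal A" unfolding F_int X_def .
    then have "X / T ^ (?n - 1) \<le> A" using A by (subst (asm) ennreal_le_iff)
    moreover have "T ^ (?n - 1) \<le> T"
      using T n2 power_decreasing[of 1 "?n - 1" T] by simp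
    then have "X / T \<le> X / T ^ (?n - 1)" using X T by (intro divide_left_mono) auto
    moreover have "A + 1 \<le> X / T" using T(1,3) A(2) by (simp add: field_simps)
    ultimately show False by simp
  qed
qed

subsection \<open>From local boundedness to quasinearly subharmonicity\<close>

lemma lifted_trunc_section: "lifted_trunc M (\<lambda>x. u (x, y)) x = lifted_trunc M u (x, y)"
  "lifted_trunc M (\<lambda>y. u (x, y)) y = lifted_trunc M u (x, y)"
  by (simp_all add: lifted_trunc_def)

lemma bounded_above_on_compact:
  fixes f :: "'a::metric_space \<Rightarrow> real"
  assumes "compact C" and "\<And>z. z \<in> C \<Longrightarrow> \<exists>e>0. \<exists>L. \<forall>w\<in>ball z e. f w \<le> L"
  obtains L where "\<And>z. z \<in> C \<Longrightarrow> f z \<le> L"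
proof -
  obtain e L where eL: "\<And>z. z \<in> C \<Longrightarrow> 0 < e z" "\<And>z w. z \<in> C \<Longrightarrow> w \<in> ball z (e z) \<Longrightarrow> f w \<le> L z"
    using assms(2) by metis
  obtain T where T: "T \<subseteq> C" "finite T" "C \<subseteq> (\<Union>z\<in>T. ball z (e z))"
  proof (rule compactE_image[OF assms(1), of C "\<lambda>z. ball z (e z)"])
    show "C \<subseteq> (\<Union>z\<in>C. ball z (e z))" using eL(1) by auto
  qed auto
  show thesis
  proof (rule that[of "Max (L ` T)"])
    fix w assume "w \<in> C"
    then obtain z where z: "z \<in> T" "w \<in> ball z (e z)" using T(3) by blast
    then have "f w \<le> L z" using T(1) by (intro eL(2)) auto
    also have "\<dots> \<le> Max (L ` T)" using T(2) z(1) by (intro Max_ge) auto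
    finally show "f w \<le> Max (L ` T)" .
  qed
qed

text \<open>Local boundedness makes the truncations integrable on compact sets. The inequality in
  \<open>x\<close> is used at the centre and the one in \<open>y\<close> at every point of the ball
  about \<open>x\<close>; the resulting iterated integral runs over a product of balls of radius
  \<open>r / 2\<close>, which lies in the ball of radius \<open>r\<close>.\<close>

lemma separately_qns_locally_bounded_imp_qns:
  fixes \<Omega> :: "('a::euclidean_space \<times> 'b::euclidean_space) set"
  assumes "open \<Omega>" and u_range: "\<forall>z\<in>\<Omega>. u z < \<infinity>"
    and u_meas: "u \<in> borel_measurable (lebesgue_on \<Omega>)"
    and a: "\<forall>y. K_quasinearly_subharmonic_on K {x. (x, y) \<in> \<Omega>} (\<lambda>x. u (x, y))"
    and b: "\<forall>x. K_quasinearly_subharmonic_on K {y. (x, y) \<in> \<Omega>} (\<lambda>y. u (x, y))"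
    and bdd: "\<And>z. z \<in> \<Omega> \<Longrightarrow> \<exists>e>0. \<exists>L. \<forall>w\<in>ball z e. pos_part u w \<le> L"
  shows "quasinearly_subharmonic_on \<Omega> u"
proof -
  let ?m = "DIM('a)" and ?n = "DIM('b)"
  have K: "1 \<le> K" and m2: "2 \<le> ?m" and n2: "2 \<le> ?n"
    using a b by (auto simp: K_quasinearly_subharmonic_on_def)
  define \<nu>a \<nu>b \<nu> where "\<nu>a = measure lebesgue (ball (0::'a) 1)" 
    and "\<nu>b = measure lebesgue (ball (0::'b) 1)"
    and "\<nu> = measure lebesgue (ball (0::'a \<times> 'b) 1)"
  have \<nu>: "0 < \<nu>a" "0 < \<nu>b" "0 < \<nu>" unfolding \<nu>a_def \<nu>b_def \<nu>_def by (rule unit_ball_measure_pos)+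
  have \<Omega>_sets: "\<Omega> \<in> sets lebesgue" using \<open>open \<Omega>\<close> by simp
  have int: "set_integrable lebesgue C (lifted_trunc M u)" if C: "compact C" "C \<subseteq> \<Omega>" and M: "0 \<le> M" for C M
  proof -
    obtain L where L: "\<And>z. z \<in> C \<Longrightarrow> pos_part u z \<le> L"
      using bounded_above_on_compact[OF C(1), of "pos_part u"] bdd C(2) by blast
    have C_sets: "C \<in> sets lebesgue" using C(1) by (simp add: borel_compact)
    have "emeasure lebesgue C < \<infinity>"
      using emeasure_compact_finite[OF C(1)] C(1) by (simp add: borel_compact)
    have "lifted_trunc M u \<in> borel_measurable (lebesgue_on \<Omega>)"
      unfolding lifted_trunc_def using u_meas by measurable
    then have "(\<lambda>z. indicator \<Omega> z *\<^sub>R lifted_trunc M u z) \<in> borel_measurable lebesgue"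
      using \<Omega>_sets by (subst (asm) borel_measurable_restrict_space_iff) auto
    then have "(\<lambda>z. indicator C z *\<^sub>R (indicator \<Omega> z *\<^sub>R lifted_trunc M u z)) \<in> borel_measurable lebesgue"
      by (rule borel_measurable_scaleR[OF borel_measurable_indicator[OF C_sets]])
    also have "(\<lambda>z. indicator C z *\<^sub>R (indicator \<Omega> z *\<^sub>R lifted_trunc M u z))
        = (\<lambda>z. indicator C z *\<^sub>R lifted_trunc M u z)"
      using C(2) by (auto simp: indicator_def fun_eq_iff)
    finally show ?thesis
      unfolding set_integrable_def
    proof (rule integrableI_bounded_set[rotated 1, where A = C and B = "L + M"])
      show "AE z\<in>C in lebesgue. norm (indicator C z *\<^sub>R lifted_trunc M u z) \<le> L + M"
      proof (intro AE_I2 impI)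
        fix z assume "z \<in> C"
        then show "norm (indicator C z *\<^sub>R lifted_trunc M u z) \<le> L + M"
          using L[of z] lifted_trunc_le[OF M, of u z] lifted_trunc_nonneg[OF M, of u z] by simp
      qed
    qed (use C_sets \<open>emeasure lebesgue C < \<infinity>\<close> in auto)
  qed
  \<comment> \<open>\<open>K\<^sup>2\<close> comes from the two mean values, the power of 2 from
    halving the radius, the quotient of unit ball volumes from normalizing by the full ball. The
    maximum provides \<open>1 \<le> K'\<close>.\<close>
  define K' where "K' = max 1 (K\<^sup>2 * 2 ^ (?m + ?n) * \<nu> / (\<nu>a * \<nu>b))"
  have mean: "lifted_trunc M u z \<le> K' / (\<nu> * r ^ (?m + ?n)) * (LINT w:ball z r|lebesgue. lifted_trunc M u w)"
    if r: "0 < r" "cball z r \<subseteq> \<Omega>" and M: "0 \<le> M" for z r M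
  proof -
    obtain x y where z: "z = (x, y)" by (cases z)
    define f where "f = lifted_trunc M u"
    have f_nonneg: "0 \<le> f w" for w unfolding f_def by (rule lifted_trunc_nonneg[OF M])
    define s where "s = r / 2"
    have s: "0 < s" using r by (simp add: s_def)
    have prod: "cball x s \<times> cball y s \<subseteq> cball z r"
    proof
      fix w assume "w \<in> cball x s \<times> cball y s"
      then obtain x' y' where w: "w = (x', y')" "dist x x' \<le> s" "dist y y' \<le> s" by auto
      have "dist z w \<le> dist x x' + dist y y'"
        unfolding z w dist_Pair_Pair by (rule sqrt_sum_squares_le_sum) auto
      then show "w \<in> cball z r" using w by (simp add: s_def)
    qed
    have prod': "ball x s \<times> ball y s \<subseteq> ball z r"
    proof
      fix w assume "w \<in> ball x s \<times> ball y s"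
      then obtain x' y' where w: "w = (x', y')" "dist x x' < s" "dist y y' < s" by auto
      have "dist z w \<le> dist x x' + dist y y'"
        unfolding z w dist_Pair_Pair by (rule sqrt_sum_squares_le_sum) auto
      then show "w \<in> ball z r" using w by (simp add: s_def)
    qed
    have int_r: "integrable lebesgue (\<lambda>w. indicator (ball z r) w *\<^sub>R f w)"
      using set_integrable_subset[OF int[OF compact_cball r(2) M], of "ball z r"] ball_subset_cball
      unfolding f_def set_integrable_def by auto
    have "(\<lambda>w. indicator (ball x s \<times> ball y s) w *\<^sub>R (indicator (ball z r) w *\<^sub>R f w)) \<in> borel_measurable lebesgue"
    proof (rule borel_measurable_scaleR[OF borel_measurable_indicator borel_measurable_integrable[OF int_r]])
      show "ball x s \<times> ball y s \<in> sets lebesgue"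
        using open_Times[OF open_ball[of x s] open_ball[of y s]] by simp
    qed
    also have "(\<lambda>w. indicator (ball x s \<times> ball y s) w *\<^sub>R (indicator (ball z r) w *\<^sub>R f w))
      = (\<lambda>w. indicator (ball x s \<times> ball y s) w * f w)"
      using prod' by (fastforce simp: indicator_def fun_eq_iff)
    finally have "(\<lambda>w. ennreal (indicator (ball x s \<times> ball y s) w * f w)) \<in> borel_measurable lebesgue"
      by measurable
    \<comment> \<open>The Borel majorant has inner integrals measurable in \<open>x'\<close> and
      controls the section at every \<open>x'\<close>, with no loss in the total integral.\<close>
    then obtain h where h: "h \<in> borel_measurable borel"
      "\<And>w. ennreal (indicator (ball x s \<times> ball y s) w * f w) \<le> h w"
      "(\<integral>\<^sup>+w. h w \<partial>lborel) = (\<integral>\<^sup>+w. ennreal (indicator (ball x s \<times> ball y s) w * f w) \<partial>lebesgue)"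
      by (rule lebesgue_borel_majorant) blast
    have h_pair: "h \<in> borel_measurable (lborel \<Otimes>\<^sub>M lborel)"
      using h(1) by (simp add: lborel_prod)
    define I where "I = (LINT w:ball z r|lebesgue. f w)"
    have I: "0 \<le> I" unfolding I_def set_lebesgue_integral_def
      using f_nonneg by (intro integral_nonneg_AE) auto
    define ca cb where "ca = K / (\<nu>a * s ^ ?m)" and "cb = K / (\<nu>b * s ^ ?n)"
    have c: "0 \<le> ca" "0 \<le> cb" using K \<nu> s by (auto simp: ca_def cb_def)
    have "ennreal (f (x, y)) \<le> ennreal ca * (\<integral>\<^sup>+x'\<in>ball x s. ennreal (f (x', y)) \<partial>lebesgue)"
      unfolding f_def ca_def \<nu>a_def
    proof (rule K_quasinearly_subharmonic_mean_nn[where v = "\<lambda>x. u (x, y)" and x = x, unfolded lifted_trunc_section])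
      have "y \<in> cball y s" using s by simp
      then show "cball x s \<subseteq> {x. (x, y) \<in> \<Omega>}" using prod r by blast
    qed (use a s M in auto)
    also have "\<dots> \<le> ennreal ca * (\<integral>\<^sup>+x'. ennreal cb * (\<integral>\<^sup>+y'. h (x', y') \<partial>lborel) \<partial>lebesgue)"
    proof (intro mult_left_mono nn_integral_mono)
      fix x' :: 'a
      show "ennreal (f (x', y)) * indicator (ball x s) x' \<le> ennreal cb * (\<integral>\<^sup>+y'. h (x', y') \<partial>lborel)"
      proof (cases "x' \<in> ball x s")
        case True
        have "ennreal (f (x', y)) \<le> ennreal cb * (\<integral>\<^sup>+y'\<in>ball y s. ennreal (f (x', y')) \<partial>lebesgue)"
          unfolding f_def cb_def \<nu>b_def
        proof (rule K_quasinearly_subharmonic_mean_nn[where v = "\<lambda>y. u (x', y)" and x = y, unfolded lifted_trunc_section])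
          have "x' \<in> cball x s" using True by simp
          then show "cball y s \<subseteq> {y. (x', y) \<in> \<Omega>}" using prod r by blast
        qed (use b s M in auto)
        also have "(\<integral>\<^sup>+y'\<in>ball y s. ennreal (f (x', y')) \<partial>lebesgue) \<le> (\<integral>\<^sup>+y'. h (x', y') \<partial>lebesgue)"
        proof (rule nn_integral_mono)
          fix y'
          show "ennreal (f (x', y')) * indicator (ball y s) y' \<le> h (x', y')"
            using h(2)[of "(x', y')"] True by (auto simp: indicator_def split: if_splits)
        qed
        finally show ?thesis using True by (simp add: mult_left_mono nn_integral_completion)
      qed simp
    qed simp
    also have "(\<integral>\<^sup>+x'. ennreal cb * (\<integral>\<^sup>+y'. h (x', y') \<partial>lborel) \<partial>lebesgue)
      = ennreal cb * (\<integral>\<^sup>+x'. (\<integral>\<^sup>+y'. h (x', y') \<partial>lborel) \<partial>lborel)"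
      unfolding nn_integral_completion
      using h_pair by (intro nn_integral_cmult lborel.borel_measurable_nn_integral_fst)
    also have "(\<integral>\<^sup>+x'. (\<integral>\<^sup>+y'. h (x', y') \<partial>lborel) \<partial>lborel) = (\<integral>\<^sup>+w. h w \<partial>lborel)"
      using lborel.nn_integral_fst[OF h_pair] by (simp add: lborel_prod)
    also have "\<dots> \<le> (\<integral>\<^sup>+w. ennreal (indicator (ball z r) w *\<^sub>R f w) \<partial>lebesgue)"
      unfolding h(3) using prod' f_nonneg by (intro nn_integral_mono ennreal_leI) (auto simp: indicator_def)
    also have "\<dots> = ennreal I"
      unfolding I_def set_lebesgue_integral_def using int_r f_nonneg
      by (intro nn_integral_eq_integral) auto
    finally have "ennreal (f z) \<le> ennreal ca * (ennreal cb * ennreal I)"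
      by (simp add: z mult_left_mono)
    also have "\<dots> = ennreal (ca * cb * I)"
      using c I by (simp add: ennreal_mult mult.assoc)
    finally have "f z \<le> ca * cb * I"
      using c I by (subst (asm) ennreal_le_iff) auto
    also have "ca * cb = (K\<^sup>2 * 2 ^ (?m + ?n) * \<nu> / (\<nu>a * \<nu>b)) / (\<nu> * r ^ (?m + ?n))"
      using \<nu> r by (simp add: ca_def cb_def s_def power_divide power_add power2_eq_square mult_ac)
    also have "\<dots> * I \<le> K' / (\<nu> * r ^ (?m + ?n)) * I"
      using I \<nu> r by (intro mult_right_mono divide_right_mono) (auto simp: K'_def)
    finally show ?thesis by (simp add: f_def I_def)
  qed
  have "K_quasinearly_subharmonic_on K' \<Omega> u"
    unfolding K_quasinearly_subharmonic_on_def
  proof (intro conjI allI impI)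
    show "pos_part u locally_integrable_on \<Omega>"
      using int[where M = 0] by (auto simp: locally_integrable_on_def lifted_trunc_0)
    show "lifted_trunc M u z \<le> K' / (measure lebesgue (ball (0::'a \<times> 'b) 1) * r ^ DIM('a \<times> 'b)) *
        (LINT w:ball z r|lebesgue. lifted_trunc M u w)"
      if "0 < r \<and> cball z r \<subseteq> \<Omega> \<and> 0 \<le> M" for z r M
      using mean[of r z M] that by (simp add: \<nu>_def)
  qed (use m2 \<open>open \<Omega>\<close> u_range u_meas in \<open>auto simp: K'_def\<close>)
  then show ?thesis
    unfolding quasinearly_subharmonic_on_def by (intro exI[of _ K']) (simp add: K'_def)
qed

subsection \<open>The integral condition\<close>

text \<open>The intervals \<open>{real j - 1<..real j}\<close> are disjoint, so the sum is the
  integral of a step function lying below \<open>f\<close>.\<close>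

lemma sum_le_integral_steps:
  fixes f :: "real \<Rightarrow> real" and t :: "nat \<Rightarrow> real"
  assumes f: "integrable lborel f" "\<And>s. 0 \<le> f s" and "finite J"
    and t: "\<And>j s. j \<in> J \<Longrightarrow> real j - 1 < s \<Longrightarrow> s \<le> real j \<Longrightarrow> t j \<le> f s"
  shows "(\<Sum>j\<in>J. t j) \<le> (\<integral>s. f s \<partial>lborel)"
proof -
  have "(\<Sum>j\<in>J. t j) = (\<integral>s. (\<Sum>j\<in>J. t j * indicator {real j - 1<..real j} s) \<partial>lborel)"
    by (subst Bochner_Integration.integral_sum) auto
  also have "\<dots> \<le> (\<integral>s. f s \<partial>lborel)"
  proof (rule integral_mono[OF _ f(1)])
    fix s :: real
    \<comment> \<open>The condition \<open>- 1 < s\<close> matters for \<open>j = 0\<close>, since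
      \<open>nat\<close> sends every negative ceiling to 0.\<close>
    have eq: "t j * indicator {real j - 1<..real j} s = (if j = nat \<lceil>s\<rceil> \<and> - 1 < s then t j else 0)" for j
    proof -
      have "s \<in> {real j - 1<..real j} \<longleftrightarrow> j = nat \<lceil>s\<rceil> \<and> - 1 < s"
        by (auto simp: ceiling_eq_iff nat_eq_iff) linarith+
      then show ?thesis by (auto simp: indicator_def)
    qed
    have "(\<Sum>j\<in>J. t j * indicator {real j - 1<..real j} s) = (if nat \<lceil>s\<rceil> \<in> J \<and> - 1 < s then t (nat \<lceil>s\<rceil>) else 0)"
      unfolding eq using \<open>finite J\<close> by (cases "- 1 < s") (auto simp: sum.delta)
    also have "\<dots> \<le> f s"
      using f(2)[of s] t[of "nat \<lceil>s\<rceil>" s] by (auto; linarith)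
    finally show "(\<Sum>j\<in>J. t j * indicator {real j - 1<..real j} s) \<le> f s" .
  qed auto
  finally show ?thesis .
qed

text \<open>For \<open>s\<close> in \<open>{real j - 1<..real j}\<close> one has
  \<open>j + 1 \<le> s + 2\<close> and \<open>s \<le> j\<close>, so by monotonicity the quotient of
  \<open>g\<close> and the factor \<open>1 / \<phi>\<close> at \<open>s\<close> dominate those at
  \<open>j\<close>. Hence the integrals dominate the inner sums and then the series. The 3 in
  \<open>q\<close> puts the unit intervals of the inner sums above the lower limit
  \<open>s5 + s0 + 2\<close>.\<close>

lemma integral_condition_imp_summable:
  fixes g \<phi> :: "real \<Rightarrow> real" and \<alpha> \<beta> \<gamma> s5 :: real and s0 q :: nat
  assumes exps: "0 \<le> \<alpha>" "0 \<le> \<beta>" "0 \<le> \<gamma>"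
    and g_mono: "\<And>s t. s5 \<le> s \<Longrightarrow> s \<le> t \<Longrightarrow> g s \<le> g t" and g_pos: "\<And>s. s5 \<le> s \<Longrightarrow> 0 < g s"
    and \<phi>_mono: "\<And>s t. s5 - real s0 \<le> s \<Longrightarrow> s \<le> t \<Longrightarrow> \<phi> s \<le> \<phi> t"
    and \<phi>_pos: "\<And>s. s5 - real s0 \<le> s \<Longrightarrow> 0 < \<phi> s"
    and s5: "real s0 \<le> s5" and q: "q = nat \<lceil>s5\<rceil> + 3"
    and int: "set_integrable lborel {s5..} (\<lambda>s. (g (s + 2) / g s * (1 / \<phi> (s - real s0))) powr \<alpha> *
          (LBINT t:{s5 + real s0 + 2..s + real s0 + 2}. (g (t + 2) / g t) powr \<beta>) powr \<gamma>)"
  shows "summable (\<lambda>j. (g (real (Suc (j + q))) / g (real (j + q)) / \<phi> (real (j + q - s0))) powr \<alpha> *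
     (\<Sum>i\<le>j. (g (real (Suc (i + (q + s0)))) / g (real (i + (q + s0)))) powr \<beta>) powr \<gamma>)"
proof -
  define b where "b t = (g (t + 2) / g t) powr \<beta>" for t
  define H where "H s = (LBINT t:{s5 + real s0 + 2..s + real s0 + 2}. b t)" for s
  define c where "c s = (g (s + 2) / g s * (1 / \<phi> (s - real s0))) powr \<alpha>" for s
  define bb where "bb i = (g (real (Suc i)) / g (real i)) powr \<beta>" for i
  define cc where "cc j = (g (real (Suc j)) / g (real j) / \<phi> (real (j - s0))) powr \<alpha>" for j
  have q_le: "s5 + 3 \<le> real q" unfolding q by linarith
  have ratio: "g (real (Suc j)) / g (real j) \<le> g (s + 2) / g s"
    if "s5 \<le> s" "real j - 1 < s" "s \<le> real j" for j s
    using that by (intro frac_le g_mono less_imp_le[OF g_pos] g_pos) auto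
  have ratio_pos: "0 < g (real (Suc j)) / g (real j)" if "s5 \<le> real j" for j
    using that by (intro divide_pos_pos g_pos) auto
  have bb_le: "bb j \<le> b s" if "s5 \<le> s" "real j - 1 < s" "s \<le> real j" for j s
    unfolding bb_def b_def using ratio[OF that] ratio_pos[of j] that exps
    by (intro powr_mono2) auto
  have cc_le: "cc j \<le> c s" if "s5 \<le> s" "real j - 1 < s" "s \<le> real j" for j s
  proof -
    have j: "real (j - s0) = real j - real s0" using that s5 by simp
    have "g (real (Suc j)) / g (real j) / \<phi> (real (j - s0)) \<le> g (s + 2) / g s / \<phi> (s - real s0)"
    proof (rule frac_le[OF _ ratio[OF that]])
      show "0 \<le> g (s + 2) / g s" using ratio[OF that] ratio_pos[of j] that by simp
    qed (use that j in \<open>auto intro!: \<phi>_mono \<phi>_pos\<close>)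
    moreover have "0 \<le> g (real (Suc j)) / g (real j) / \<phi> (real (j - s0))"
      
      using less_imp_le[OF ratio_pos[of j]] \<phi>_pos[of "real (j - s0)"] that j
      by (intro divide_nonneg_pos[of "g (real (Suc j)) / g (real j)"]) auto
    ultimately show ?thesis
      unfolding cc_def c_def using exps by (intro powr_mono2) auto
  qed
  have b_nonneg: "0 \<le> b t" for t by (simp add: b_def)
  \<comment> \<open>Without integrability \<open>H s\<close> would be the default value 0 and could
    not dominate the inner sums.\<close>
  have b_int: "set_integrable lborel {s5 + real s0 + 2..s + real s0 + 2} b" for s
  proof -
    let ?A = "{s5 + real s0 + 2..s + real s0 + 2}"
    \<comment> \<open>\<open>g\<close> is controlled only from \<open>s5\<close> on; freezing it
      below \<open>s5\<close> gives a function monotone on the whole line, hence Borel.\<close>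
    define g' where "g' t = g (max t s5)" for t
    have "mono g'" unfolding g'_def by (intro monoI g_mono) auto
    then have g'_meas [measurable]: "g' \<in> borel_measurable borel" by (rule borel_measurable_mono)
    have "(\<lambda>t. indicator ?A t *\<^sub>R b t) = (\<lambda>t. indicator ?A t *\<^sub>R (g' (t + 2) / g' t) powr \<beta>)"
      by (auto simp: fun_eq_iff b_def g'_def indicator_def max_def)
    moreover have "(\<lambda>t. indicator ?A t *\<^sub>R (g' (t + 2) / g' t) powr \<beta>) \<in> borel_measurable lborel"
      by measurable
    ultimately have meas: "(\<lambda>t. indicator ?A t *\<^sub>R b t) \<in> borel_measurable lborel" by simp
    have bound: "b t \<le> (g (s + real s0 + 4) / g (s5 + real s0 + 2)) powr \<beta>" if "t \<in> ?A" for t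
    proof -
      have "g (t + 2) / g t \<le> g (s + real s0 + 4) / g (s5 + real s0 + 2)"
        using that by (intro frac_le g_mono less_imp_le[OF g_pos] g_pos) auto
      moreover have "0 < g (t + 2) / g t" using that by (intro divide_pos_pos g_pos) auto
      ultimately show ?thesis unfolding b_def using exps by (intro powr_mono2) auto
    qed
    show ?thesis
      unfolding set_integrable_def using bound b_nonneg
      by (intro integrableI_bounded_set[OF _ meas, where A = ?A 
            and B = "(g (s + real s0 + 4) / g (s5 + real s0 + 2)) powr \<beta>"])
        (auto simp: indicator_def emeasure_lborel_Icc_eq)
  qed
  have H_ge: "(\<Sum>i\<le>j. bb (i + (q + s0))) \<le> H s" if s: "real (j + q) - 1 < s" "s \<le> real (j + q)" for j s
  proof -
    have "(\<Sum>i\<le>j. bb (i + (q + s0))) = (\<Sum>i\<in>{q + s0..j + (q + s0)}. bb i)"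
      by (rule sum.reindex_bij_witness[of _ "\<lambda>i. i - (q + s0)" "\<lambda>i. i + (q + s0)"]) auto
    also have "\<dots> \<le> (\<integral>t. indicator {s5 + real s0 + 2..s + real s0 + 2} t *\<^sub>R b t \<partial>lborel)"
    proof (rule sum_le_integral_steps)
      show "integrable lborel (\<lambda>t. indicator {s5 + real s0 + 2..s + real s0 + 2} t *\<^sub>R b t)"
        using b_int[of s] by (simp add: set_integrable_def)
      fix i t assume i: "i \<in> {q + s0..j + (q + s0)}" and t: "real i - 1 < t" "t \<le> real i"
      \<comment> \<open>\<open>t\<close> exceeds \<open>q + s0 - 1\<close>, which is at least
        \<open>s5 + s0 + 2\<close>, and is at most \<open>j + q + s0\<close>, which is below
        \<open>s + s0 + 1\<close>.\<close>
      have "real (q + s0) \<le> real i" "real i \<le> real (j + (q + s0))"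
        using i by (simp_all only: of_nat_le_iff atLeastAtMost_iff)
      then have "t \<in> {s5 + real s0 + 2..s + real s0 + 2}" using t s q_le by auto
      moreover have "bb i \<le> b t" using t calculation by (intro bb_le) auto
      ultimately show "bb i \<le> indicator {s5 + real s0 + 2..s + real s0 + 2} t *\<^sub>R b t" by simp
    qed (auto simp: b_nonneg)
    finally show ?thesis by (simp add: H_def set_lebesgue_integral_def)
  qed
  have "summable (\<lambda>j. cc (j + q) * (\<Sum>i\<le>j. bb (i + (q + s0))) powr \<gamma>)"
  proof (rule summableI_nonneg_bounded)
    show "0 \<le> cc (j + q) * (\<Sum>i\<le>j. bb (i + (q + s0))) powr \<gamma>" for j by (simp add: cc_def)
    fix n
    have "(\<Sum>j<n. cc (j + q) * (\<Sum>i\<le>j. bb (i + (q + s0))) powr \<gamma>)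
       = (\<Sum>j\<in>{q..<n + q}. cc j * (\<Sum>i\<le>j - q. bb (i + (q + s0))) powr \<gamma>)"
      by (rule sum.reindex_bij_witness[of _ "\<lambda>j. j - q" "\<lambda>j. j + q"]) auto
    also have "\<dots> \<le> (\<integral>s. indicator {s5..} s *\<^sub>R (c s * H s powr \<gamma>) \<partial>lborel)"
    proof (rule sum_le_integral_steps)
      show "integrable lborel (\<lambda>s. indicator {s5..} s *\<^sub>R (c s * H s powr \<gamma>))"
        using int by (simp add: set_integrable_def c_def H_def b_def)
      show "0 \<le> indicator {s5..} s *\<^sub>R (c s * H s powr \<gamma>)" for s by (simp add: c_def)
      fix j s assume j: "j \<in> {q..<n + q}" and s: "real j - 1 < s" "s \<le> real j"
      have "real q \<le> real j" using j by simp
      then have s5_le: "s5 \<le> s" using s q_le by simp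
      have "(\<Sum>i\<le>j - q. bb (i + (q + s0))) \<le> H s"
        using j s by (intro H_ge) auto
      then have "(\<Sum>i\<le>j - q. bb (i + (q + s0))) powr \<gamma> \<le> H s powr \<gamma>"
        using exps by (intro powr_mono2) (auto intro: sum_nonneg simp: bb_def)
      then have "cc j * (\<Sum>i\<le>j - q. bb (i + (q + s0))) powr \<gamma> \<le> c s * H s powr \<gamma>"
        using cc_le[OF s5_le s] by (intro mult_mono) (auto simp: c_def)
      then show "cc j * (\<Sum>i\<le>j - q. bb (i + (q + s0))) powr \<gamma> \<le> indicator {s5..} s *\<^sub>R (c s * H s powr \<gamma>)"
        using s5_le by simp
    qed simp
    finally show "(\<Sum>j<n. cc (j + q) * (\<Sum>i\<le>j. bb (i + (q + s0))) powr \<gamma>)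
      \<le> (\<integral>s. indicator {s5..} s *\<^sub>R (c s * H s powr \<gamma>) \<partial>lborel)" .
  qed
  then show ?thesis by (simp only: cc_def bb_def)
qed

section \<open>The level sequence of the given functions and the conclusion\<close>

theorem theorem4p1:
  fixes K :: real
    and \<Omega> :: "((real ^ 'm) \<times> (real ^ 'n)) set"
    and u :: "(real ^ 'm) \<times> (real ^ 'n) \<Rightarrow> ereal"
    and \<phi> \<psi> :: "real \<Rightarrow> real"
    and s0 s1 :: nat
    and g :: "real \<Rightarrow> real"
    and s5 :: real
  assumes K: "K \<ge> 1"
    and dims: "CARD('m) \<ge> CARD('n)" "CARD('n) \<ge> 2"
    and domain: "open \<Omega>" "connected \<Omega>" "\<Omega> \<noteq> {}"
    and u_range: "\<forall>z\<in>\<Omega>. u z < \<infinity>"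
    and u_meas: "u \<in> borel_measurable (lebesgue_on \<Omega>)"
    and a: "\<forall>y. K_quasinearly_subharmonic_on K {x. (x, y) \<in> \<Omega>} (\<lambda>x. u (x, y))"
    and b: "\<forall>x. K_quasinearly_subharmonic_on K {y. (x, y) \<in> \<Omega>} (\<lambda>y. u (x, y))"
    and \<phi>: "\<phi> \<in> {0..} \<rightarrow> {0..}" "mono_on {0..} \<phi>"
    and \<psi>: "\<psi> \<in> {0..} \<rightarrow> {0..}" "mono_on {0..} \<psi>"
    and s0_s1: "s0 < s1"
    and c1: "inverse_defined_on {min (\<phi> (real s1 - real s0)) (\<psi> (real s1 - real s0))..} \<phi>"
            "inverse_defined_on {min (\<phi> (real s1 - real s0)) (\<psi> (real s1 - real s0))..} \<psi>"
    and g: "g = inv_into {0..} \<psi> \<circ> \<phi>"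
    and c2: "\<forall>s\<ge>real s1. 2 * K * g (s - real s0) \<le> g s"
    and s5: "s5 = Max {real s0 + real s1 + 3,
                       real s0 + g (real s1 + 3),
                       real s0 + (inv_into {0..} \<phi> \<circ> \<psi>) (real s1 + 3)}"
    and c3: "set_integrable lborel {s5..} (\<lambda>s.
               (g (s + 2) / g s * (1 / \<phi> (s - real s0))) powr (1 / (real CARD('m) - 1)) *
               (LBINT t:{s5 + real s0 + 2..s + real s0 + 2}.
                  (g (t + 2) / g t) powr (1 / (real CARD('n) - 1)))
               powr ((real CARD('n) - 1) / (real CARD('m) - 1)))"
    and c4: "(\<psi> \<circ> pos_part u) locally_integrable_on \<Omega>"
  shows "quasinearly_subharmonic_on \<Omega> u"
proof -
  define a0 where "a0 = real s1 - real s0"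
  define I where "I = {min (\<phi> a0) (\<psi> a0)..}"
  have a0: "0 < a0" using s0_s1 by (simp add: a0_def)
  have inv: "inverse_defined_on I \<phi>" "inverse_defined_on I \<psi>"
    using c1 by (simp_all add: I_def a0_def)
  have \<phi>_mono: "\<phi> s \<le> \<phi> t" and \<psi>_mono: "\<psi> s \<le> \<psi> t" if "0 \<le> s" "s \<le> t" for s t
    using that \<phi>(2) \<psi>(2) by (auto simp: mono_on_def)
  have \<phi>_I: "\<phi> s \<in> I" if "a0 \<le> s" for s
    using \<phi>_mono[of a0 s] that a0 by (simp add: I_def min.coboundedI1)
  \<comment> \<open>From \<open>a0\<close> on, \<open>\<phi> s\<close> lies in the interval of
    invertibility, so \<open>inv_into\<close> yields a genuine preimage under \<open>\<psi>\<close>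
    and not an arbitrary value.\<close>
  have g_nonneg: "0 \<le> g s" and \<psi>_g: "\<psi> (g s) = \<phi> s" if "a0 \<le> s" for s
  proof -
    have "\<phi> s \<in> \<psi> ` {0..}"
      using inv(2) \<phi>_I[OF that] unfolding inverse_defined_on_def by (metis image_eqI)
    then show "0 \<le> g s" "\<psi> (g s) = \<phi> s"
      using inv_into_into[of "\<phi> s" \<psi> "{0..}"] f_inv_into_f[of "\<phi> s" \<psi> "{0..}"]
      by (simp_all add: g)
  qed
  have \<psi>_inj: "x = y" if "0 \<le> x" "0 \<le> y" "\<psi> x = \<psi> y" "\<psi> x \<in> I" for x y
    using inv(2) that unfolding inverse_defined_on_def by (metis atLeast_iff)
  have \<phi>_inj: "x = y" if "0 \<le> x" "0 \<le> y" "\<phi> x = \<phi> y" "\<phi> x \<in> I" for x y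
    using inv(1) that unfolding inverse_defined_on_def by (metis atLeast_iff)
  \<comment> \<open>Uniqueness of preimages turns monotone into strictly monotone; strictness passes
    to \<open>g\<close> through \<open>\<psi>_g\<close>, and positivity beyond \<open>a0\<close>
    follows for both.\<close>
  have \<phi>_strict: "\<phi> s < \<phi> t" if "a0 \<le> s" "s < t" for s t
    using \<phi>_mono[of s t] \<phi>_inj[of s t] \<phi>_I[of s] that a0 by (cases "\<phi> s = \<phi> t") auto
  have \<phi>_pos: "0 < \<phi> s" if "a0 < s" for s
  proof -
    have "0 \<le> \<phi> a0" using \<phi>(1) a0 by (simp add: Pi_iff)
    then show ?thesis using \<phi>_strict[of a0 s] that by simp
  qed
  have g_strict: "g s < g t" if "a0 \<le> s" "s < t" for s t
  proof (rule ccontr)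
    assume "\<not> g s < g t"
    then have "\<psi> (g t) \<le> \<psi> (g s)" using g_nonneg[of t] that by (intro \<psi>_mono) auto
    then show False using \<phi>_strict[OF that] \<psi>_g[of s] \<psi>_g[of t] that by simp
  qed
  have g_mono: "g s \<le> g t" if "a0 \<le> s" "s \<le> t" for s t
    using g_strict[of s t] that by (cases "s = t") auto
  have g_pos: "0 < g s" if "a0 < s" for s
    using g_strict[of a0 s] g_nonneg[of a0] that by simp
  have s5_ge: "real s0 + real s1 + 3 \<le> s5" unfolding s5 by (intro Max_ge) auto

  define G where "G j = g (real j)" for j :: nat
  have a0_lt: "a0 < real j" if "s1 + 1 \<le> j" for j
  proof -
    have "real (s1 + 1) \<le> real j" using that by (simp only: of_nat_le_iff)
    then show ?thesis by (simp add: a0_def)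
  qed
  have G_pos: "0 < G j" if "s1 + 1 \<le> j" for j
    unfolding G_def by (rule g_pos[OF a0_lt[OF that]])
  have G_mono: "G i \<le> G j" if "s1 + 1 \<le> i" "i \<le> j" for i j
    unfolding G_def using a0_lt[OF that(1)] that(2) by (intro g_mono) auto
  have G_doubling: "2 * K * G j \<le> G (j + s0)" if "s1 + 1 \<le> j" for j
    using c2[rule_format, of "real (j + s0)"] that by (simp add: G_def)
  \<comment> \<open>As \<open>K \<ge> 1\<close>, condition \<open>c2\<close> at least doubles
    \<open>G\<close> over every \<open>s0\<close> indices, so \<open>G\<close> is unbounded.\<close>
  have G_growth: "2 ^ k * G (s1 + 1) \<le> G (s1 + 1 + k * s0)" for k
  proof (induction k)
    case (Suc k)
    have "2 ^ Suc k * G (s1 + 1) \<le> 2 * G (s1 + 1 + k * s0)" using Suc by simp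
    also have "\<dots> \<le> 2 * K * G (s1 + 1 + k * s0)"
      using K G_pos[of "s1 + 1 + k * s0"] by simp
    also have "\<dots> \<le> G (s1 + 1 + k * s0 + s0)" by (rule G_doubling) simp
    finally show ?case by (simp add: add_ac)
  qed simp
  have G_lim: "filterlim G at_top sequentially"
    unfolding filterlim_at_top eventually_sequentially
  proof
    fix Z
    obtain k where k: "Z / G (s1 + 1) < 2 ^ k" using real_arch_pow[of 2] by fastforce
    show "\<exists>N. \<forall>n\<ge>N. Z \<le> G n"
    proof (intro exI allI impI)
      fix n assume n: "s1 + 1 + k * s0 \<le> n"
      have "Z \<le> 2 ^ k * G (s1 + 1)" using k G_pos[of "s1 + 1"] by (simp add: field_simps)
      also have "\<dots> \<le> G (s1 + 1 + k * s0)" by (rule G_growth)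
      also have "\<dots> \<le> G n" using n by (intro G_mono) auto
      finally show "Z \<le> G n" .
    qed
  qed

  define q where "q = nat \<lceil>s5\<rceil> + 3"
  have dims': "2 \<le> CARD('m)" using dims by simp
  have sm: "summable (\<lambda>j. (g (real (Suc (j + q))) / g (real (j + q)) / \<phi> (real (j + q - s0))) powr (1 / (real CARD('m) - 1)) *
     (\<Sum>i\<le>j. (g (real (Suc (i + (q + s0)))) / g (real (i + (q + s0)))) powr (1 / (real CARD('n) - 1)))
       powr ((real CARD('n) - 1) / (real CARD('m) - 1)))"
  proof (rule integral_condition_imp_summable[OF _ _ _ _ _ _ _ _ q_def c3])
    show "g s \<le> g t" if "s5 \<le> s" "s \<le> t" for s t
      using that s5_ge by (intro g_mono) (auto simp: a0_def)
    show "0 < g s" if "s5 \<le> s" for s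
      using that s5_ge by (intro g_pos) (auto simp: a0_def)
    show "\<phi> s \<le> \<phi> t" if "s5 - real s0 \<le> s" "s \<le> t" for s t
      using that s5_ge by (intro \<phi>_mono) auto
    show "0 < \<phi> s" if "s5 - real s0 \<le> s" for s
      using that s5_ge by (intro \<phi>_pos) (auto simp: a0_def)
  qed (use dims dims' s5_ge in auto)

  show ?thesis
  proof (rule separately_qns_locally_bounded_imp_qns[OF domain(1) u_range u_meas a b])
    fix z assume "z \<in> \<Omega>"
    obtain x0 y0 where z: "z = (x0, y0)" by (cases z)
    obtain e where e: "0 < e" "cball z e \<subseteq> \<Omega>"
      using domain(1) \<open>z \<in> \<Omega>\<close> open_contains_cball by blast
    \<comment> \<open>The product of closed balls of radius \<open>2 * \<rho> = e / 2\<close> fits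
      into \<open>cball z e\<close>.\<close>
    define \<rho> where "\<rho> = e / 4"
    have \<rho>: "0 < \<rho>" using e by (simp add: \<rho>_def)
    have sub: "cball x0 (2 * \<rho>) \<times> cball y0 (2 * \<rho>) \<subseteq> \<Omega>"
    proof
      fix w assume "w \<in> cball x0 (2 * \<rho>) \<times> cball y0 (2 * \<rho>)"
      then obtain x y where w: "w = (x, y)" "dist x0 x \<le> 2 * \<rho>" "dist y0 y \<le> 2 * \<rho>" by auto
      have "dist z w \<le> dist x0 x + dist y0 y"
        unfolding z w dist_Pair_Pair by (rule sqrt_sum_squares_le_sum) auto
      then have "w \<in> cball z e" using w by (simp add: \<rho>_def)
      then show "w \<in> \<Omega>" using e by blast
    qed
    \<comment> \<open>With this \<open>p\<close>, \<open>1 / p\<close> is the outer exponent in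
      \<open>c3\<close>, so \<open>sm\<close> is the summability required.\<close>
    obtain L where L: "\<And>x y. x \<in> cball x0 \<rho> \<Longrightarrow> y \<in> cball y0 \<rho> \<Longrightarrow> pos_part u (x, y) \<le> L"
    proof (rule separately_qns_bounded_above[OF a b _ \<rho> sub, where \<psi> = \<psi> and G = G and P = "\<lambda>j. \<phi> (real j)"
          and ?q0.0 = "s1 + 1" and ?s0.0 = s0 and q = q
          and c = "\<lambda>j. (g (real (Suc j)) / g (real j) / \<phi> (real (j - s0))) powr (1 / (real CARD('m) - 1))"
          and b = "\<lambda>j. (g (real (Suc j)) / g (real j)) powr (1 / (real CARD('n) - 1))"
          and p = "(real CARD('m) - 1) / (real CARD('n) - 1)"])
      show "set_integrable lebesgue (cball x0 (2 * \<rho>) \<times> cball y0 (2 * \<rho>)) (\<psi> \<circ> pos_part u)"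
        using c4 sub by (auto simp: locally_integrable_on_def compact_Times)
      \<comment> \<open>Monotonicity of \<open>\<psi>\<close> gives
        \<open>\<psi> t \<ge> \<psi> (g j) = \<phi> j\<close>: the levels are
        \<open>\<psi>\<close>-preimages of the values of \<open>\<phi>\<close> for this
        reason.\<close>
      show "\<phi> (real j) \<le> \<psi> t" if "s1 + 1 \<le> j" "G j < t" for j t
        using that a0_lt[of j] g_nonneg[of "real j"] \<psi>_g[of "real j"] \<psi>_mono[of "g (real j)" t]
        by (simp add: G_def)
      show "0 < \<phi> (real j)" if "s1 + 1 \<le> j" for j using a0_lt[OF that] by (rule \<phi>_pos)
      have "real (s1 + 1 + s0) \<le> real q" using s5_ge unfolding q_def by simp linarith
      then show "s1 + 1 + s0 \<le> q" by (simp only: of_nat_le_iff)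
    qed (use dims G_pos G_mono G_doubling G_lim sm in \<open>auto simp: G_def\<close>)
    have "pos_part u w \<le> L" if w: "w \<in> ball z \<rho>" for w
      using L[of "fst w" "snd w"] w dist_fst_le[of z w] dist_snd_le[of z w] by (simp add: z)
    then show "\<exists>e>0. \<exists>L. \<forall>w\<in>ball z e. pos_part u w \<le> L" using \<rho> by blast
  qed
qed

end
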